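(* Let $d\ge 1$ and let $\mathbb{Z}^d\curvearrowright X$ be a free Borel action on a standard Borel space $X$, with associated grid graph $G$. Then $G$ admits a Borel $(2^d-1)$-polychromatic coloring, i.e. there is a Borel map $c:X\to \ell$ with $|\ell|=2^d-1$ such that for every $x\in X$ the unit cube $\{0,1\}^d\cdot x=\{g\cdot x: g\in\{0,1\}^d\}$ satisfies $c(\{0,1\}^d\cdot x)=\ell$.
   Context: Write $\mathbb{Z}^d=\langle e_0,\dots,e_{d-1}\rangle$ with $e_i$ the standard generators. The grid graph (Schreier graph) $G$ of a free Borel action $\mathbb{Z}^d\curvearrowright X$ has vertex set $X$ and an edge between $x$ and $e_i\cdot x$ for each $x\in X$ and $i<d$. The $d$-dimensional unit hypercubes of $G$ are the sets $\{0,1\}^d\cdot x$ for $x\in X$. A labeling $c:X\to[k]$ is Borel $k$-polychromatic if it is Borel and every unit hypercube contains vertices of all $k$ colors. *)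

theory Defs
  imports "HOL-Analysis.Analysis" "HOL-Algebra.Group_Action" "HOL-Algebra.Product_Groups"
    "HOL-Algebra.Elementary_Groups"
begin

definition polish_space :: "'a topology \<Rightarrow> bool" where
  "polish_space T \<longleftrightarrow> separable_space T \<and> completely_metrizable_space T"

text \<open>A measurable space is represented by a value of type \<^typ>\<open>'a measure\<close>, of which only
  \<^const>\<open>space\<close> and \<^const>\<open>sets\<close> are used.\<close>

definition standard_borel_space :: "'a measure \<Rightarrow> bool" where
  "standard_borel_space X \<longleftrightarrow>
     (\<exists>T. polish_space T \<and> topspace T = space X \<and>
          sets X = sigma_sets (space X) {U. openin T U})"

definition Zd_group :: "nat \<Rightarrow> (nat \<Rightarrow> int) monoid" where
  "Zd_group d = product_group {..<d} (\<lambda>_. integer_group)"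

text \<open>The acting group is discrete, so its Borel structure is the power set. The locale
  \<^locale>\<open>group_action\<close> asks each group element to act by a function that is extensional on
  \<^term>\<open>space X\<close>; this only fixes the irrelevant values outside \<^term>\<open>space X\<close>.\<close>

definition borel_action ::
    "('g, 'b) monoid_scheme \<Rightarrow> 'a measure \<Rightarrow> ('g \<Rightarrow> 'a \<Rightarrow> 'a) \<Rightarrow> bool" where
  "borel_action G X \<phi> \<longleftrightarrow>
     group_action G (space X) \<phi> \<and>
     (\<lambda>(g, x). \<phi> g x) \<in> count_space (carrier G) \<Otimes>\<^sub>M X \<rightarrow>\<^sub>M X"

definition free_action ::
    "('g, 'b) monoid_scheme \<Rightarrow> 'a set \<Rightarrow> ('g \<Rightarrow> 'a \<Rightarrow> 'a) \<Rightarrow> bool" where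
  "free_action G E \<phi> \<longleftrightarrow> (\<forall>x\<in>E. stabilizer G \<phi> x = {\<one>\<^bsub>G\<^esub>})"

definition unit_cube :: "nat \<Rightarrow> ((nat \<Rightarrow> int) \<Rightarrow> 'a \<Rightarrow> 'a) \<Rightarrow> 'a \<Rightarrow> 'a set" where
  "unit_cube d \<phi> x = {\<phi> g x | g. g \<in> {..<d} \<rightarrow>\<^sub>E {0, 1}}"

definition borel_polychromatic ::
    "nat \<Rightarrow> 'a measure \<Rightarrow> ((nat \<Rightarrow> int) \<Rightarrow> 'a \<Rightarrow> 'a) \<Rightarrow> nat \<Rightarrow> ('a \<Rightarrow> nat) \<Rightarrow> bool" where
  "borel_polychromatic d X \<phi> k c \<longleftrightarrow>
     c \<in> X \<rightarrow>\<^sub>M count_space {..<k} \<and>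
     (\<forall>x\<in>space X. c ` unit_cube d \<phi> x = {..<k})"

end

theory Submission
  imports Defs "HOL-Library.Function_Algebras"
begin

text \<open>
  Colour by the parities of \<open>d\<close> local coordinates and let the all-even and the all-odd class share a
  colour. A coordinate may be chosen afresh on every line in its own direction, as long as the other
  coordinates are consistent nearby: a unit cube then still meets every parity class, unless
  it contains a \<^emph>\<open>wall\<close>, an edge along which the coordinate fails to change parity. Such a cube misses
  a single class, and if the walls are far apart, its colour can be given to the nearby points of the
  all-even class, which is redundant.

  Consistent parities do not exist on whole orbits. Every orbit is therefore exhausted by finite
  regions whose boundaries are far apart (a Borel toast), and each region uses the coordinates
  relative to its own centre. The region used for the \<open>i\<close>-th coordinate is enlarged by a distance that
  grows with \<open>i\<close>, so that distinct coordinates never jump at the same place, and its boundary is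
  slanted, so that the walls are isolated.
\<close>

text \<open>Vectors are total functions so that they form a group under pointwise addition; freeness
  is asked only of those supported on the first \<open>d\<close> coordinates.
  \<open>separating\<close> is the form in which the Polish topology enters.\<close>

locale free_Zd_action =
  fixes d :: nat and X :: "'a measure" and act :: "(nat \<Rightarrow> int) \<Rightarrow> 'a \<Rightarrow> 'a"
  assumes act_measurable: "act v \<in> X \<rightarrow>\<^sub>M X"
    and act_zero: "x \<in> space X \<Longrightarrow> act 0 x = x"
    and act_add: "x \<in> space X \<Longrightarrow> act (u + v) x = act u (act v x)"
    and act_free: "x \<in> space X \<Longrightarrow> (\<And>i. i \<ge> d \<Longrightarrow> v i = 0) \<Longrightarrow> act v x = x \<Longrightarrow> v = 0"
    and separating: "\<exists>U :: nat \<Rightarrow> 'a set. range U \<subseteq> sets X \<and>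
      (\<forall>x\<in>space X. \<forall>F. finite F \<longrightarrow> F \<subseteq> space X - {x} \<longrightarrow> (\<exists>n. x \<in> U n \<and> U n \<inter> F = {}))"
begin

definition ibox :: "nat \<Rightarrow> (nat \<Rightarrow> int) set" where
  "ibox k = {v. (\<forall>i. \<bar>v i\<bar> \<le> int k) \<and> (\<forall>i\<ge>d. v i = 0)}"

text \<open>Balls of the sup-norm metric on orbits. As \<open>ibox k\<close> is finite, quantifying
  over a ball preserves Borel sets.\<close>

definition near :: "nat \<Rightarrow> 'a \<Rightarrow> 'a \<Rightarrow> bool" where
  "near k x y \<longleftrightarrow> (\<exists>v\<in>ibox k. act v x = y)"

definition thick :: "nat \<Rightarrow> 'a set \<Rightarrow> 'a set" where
  "thick k S = {y \<in> space X. \<exists>v\<in>ibox k. act v y \<in> S}"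

definition discrete_at :: "nat \<Rightarrow> 'a set \<Rightarrow> bool" where
  "discrete_at k M \<longleftrightarrow> (\<forall>x\<in>M. \<forall>y\<in>M. near k x y \<longrightarrow> x = y)"

subsection \<open>The orbit metric\<close>

lemma act_space [simp]: "x \<in> space X \<Longrightarrow> act v x \<in> space X"
  using act_measurable by (rule measurable_space)

lemma act_minus_act [simp]: "x \<in> space X \<Longrightarrow> act (- v) (act v x) = x"
  by (metis act_add act_zero add.left_inverse)

lemma act_act_minus [simp]: "x \<in> space X \<Longrightarrow> act v (act (- v) x) = x"
  by (metis act_add act_zero add.right_inverse)

lemma finite_ibox [simp]: "finite (ibox k)"
proof -
  have "finite {v. \<forall>i. (i \<in> {..<d} \<longrightarrow> v i \<in> {- int k..int k}) \<and> (i \<notin> {..<d} \<longrightarrow> v i = 0)}"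
    by (rule finite_set_of_finite_funs) auto
  then show ?thesis
    by (rule finite_subset[rotated]) (auto simp: ibox_def abs_le_iff minus_le_iff not_less)
qed

lemma zero_in_ibox [simp]: "0 \<in> ibox k"
  by (auto simp: ibox_def)

lemma uminus_in_ibox [simp]: "- v \<in> ibox k \<longleftrightarrow> v \<in> ibox k"
  by (auto simp: ibox_def)

lemma add_in_ibox: "u \<in> ibox k \<Longrightarrow> v \<in> ibox l \<Longrightarrow> u + v \<in> ibox (k + l)"
  unfolding ibox_def by (auto simp: of_nat_add intro: order_trans[OF abs_triangle_ineq add_mono])

lemma ibox_mono: "k \<le> l \<Longrightarrow> v \<in> ibox k \<Longrightarrow> v \<in> ibox l"
  unfolding ibox_def by (auto intro: order_trans)

lemma ibox_support: "v \<in> ibox k \<Longrightarrow> i \<ge> d \<Longrightarrow> v i = 0"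
  by (auto simp: ibox_def)

lemma near_act [simp]: "v \<in> ibox k \<Longrightarrow> near k x (act v x)"
  by (auto simp: near_def)

lemma near_refl [simp]: "x \<in> space X \<Longrightarrow> near k x x"
  using act_zero near_act[OF zero_in_ibox] by metis

lemma near_sym:
  assumes "x \<in> space X" "near k x y" shows "near k y x"
  using assms act_minus_act uminus_in_ibox unfolding near_def by metis

lemma near_space: "near k x y \<Longrightarrow> x \<in> space X \<Longrightarrow> y \<in> space X"
  by (auto simp: near_def)

lemma near_trans:
  assumes "x \<in> space X" "near k x y" "near l y z" "k + l \<le> m" shows "near m x z"
proof -
  obtain u v where "u \<in> ibox k" "act u x = y" "v \<in> ibox l" "act v y = z"
    using assms unfolding near_def by blast
  then have "v + u \<in> ibox (l + k)" "act (v + u) x = z"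
    using add_in_ibox act_add assms(1) by auto
  then show ?thesis
    using assms(4) ibox_mono unfolding near_def by (metis add.commute)
qed

lemma near_mono: "near k x y \<Longrightarrow> k \<le> l \<Longrightarrow> near l x y"
  using ibox_mono unfolding near_def by blast

lemma thick_iff: "y \<in> thick k S \<longleftrightarrow> y \<in> space X \<and> (\<exists>x\<in>S. near k y x)"
  by (auto simp: thick_def near_def)

lemma thick_space: "thick k S \<subseteq> space X"
  by (auto simp: thick_def)

lemma near_thick:
  assumes "y \<in> thick k S" "near l y z" "k + l \<le> m" shows "z \<in> thick m S"
proof -
  obtain x where y: "y \<in> space X" and x: "x \<in> S" "near k y x"
    using assms(1) by (auto simp: thick_iff)
  have "near m z x"
    using near_trans[OF near_space[OF assms(2) y] near_sym[OF y assms(2)] x(2)] assms(3) by simp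
  then show ?thesis
    using x near_space[OF assms(2) y] by (auto simp: thick_iff)
qed

lemma thick_mono: "S \<subseteq> S' \<Longrightarrow> k \<le> l \<Longrightarrow> thick k S \<subseteq> thick l S'"
  using near_mono by (fastforce simp: thick_iff)

lemma subset_thick: "S \<subseteq> space X \<Longrightarrow> S \<subseteq> thick k S"
  using near_refl by (fastforce simp: thick_iff)

lemma thick_thick:
  assumes "y \<in> thick k (thick l S)" "k + l \<le> m" shows "y \<in> thick m S"
proof -
  obtain z where "y \<in> space X" "z \<in> thick l S" "near k y z"
    using assms(1) by (auto simp: thick_iff)
  then show ?thesis
    using near_thick near_sym assms(2) by (metis add.commute)
qed

lemma sets_act [measurable]: "S \<in> sets X \<Longrightarrow> {x \<in> space X. act v x \<in> S} \<in> sets X"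
  using measurable_sets[OF act_measurable, of S v]
  by (simp add: vimage_def Int_def conj_commute)

lemma sets_thick [measurable]:
  assumes "S \<in> sets X" shows "thick k S \<in> sets X"
proof -
  have "thick k S = (\<Union>v\<in>ibox k. {x \<in> space X. act v x \<in> S})"
    by (auto simp: thick_def)
  then show ?thesis using assms by auto
qed

subsection \<open>Borel maximal discrete sets\<close>

text \<open>Greedy choice over a countable family of discrete Borel pieces. The pieces exhaust
  \<open>Y\<close> because the punctured \<open>k\<close>-ball of a point is finite, so some
  \<open>U n\<close> isolates the point from it.\<close>

lemma maximal_discrete:
  assumes Y: "Y \<in> sets X"
  shows "\<exists>M\<in>sets X. M \<subseteq> Y \<and> discrete_at k M \<and> Y \<subseteq> thick k M"
proof -
  obtain U :: "nat \<Rightarrow> 'a set" where U: "range U \<subseteq> sets X"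
    and sep: "\<And>x F. x \<in> space X \<Longrightarrow> finite F \<Longrightarrow> F \<subseteq> space X - {x} \<Longrightarrow> \<exists>n. x \<in> U n \<and> U n \<inter> F = {}"
    using separating by metis
  \<comment> \<open>Points that are alone in \<open>U n\<close> within their \<open>k\<close>-ball,
    so that \<open>W n\<close> is itself discrete at scale \<open>k\<close>.\<close>
  define W where "W n = {x \<in> Y \<inter> U n. \<forall>v\<in>ibox k - {0}. act v x \<notin> U n}" for n
  have W: "W n \<in> sets X" for n
  proof -
    have "W n = (Y \<inter> U n) - (\<Union>v\<in>ibox k - {0}. {x \<in> space X. act v x \<in> U n})"
      using sets.sets_into_space[OF Y] by (auto simp: W_def)
    moreover have "{x \<in> space X. act v x \<in> U n} \<in> sets X" for v
      using U by (intro sets_act) auto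
    ultimately show ?thesis
      using Y U by (auto intro!: sets.Diff sets.Int sets.finite_UN)
  qed
  define G where "G = rec_nat {} (\<lambda>n S. S \<union> (W n - thick k S))"
  have G0: "G 0 = {}" and GS: "G (Suc n) = G n \<union> (W n - thick k (G n))" for n
    by (auto simp: G_def)
  have G: "G n \<in> sets X" for n
    by (induction n) (use W in \<open>auto simp: G0 GS intro: sets_thick\<close>)
  have GY: "G n \<subseteq> Y" for n
    by (induction n) (auto simp: G0 GS W_def)
  have sp: "G n \<subseteq> space X" for n
    using sets.sets_into_space[OF G] .
  have "mono G"
    unfolding mono_iff_le_Suc by (auto simp: GS)
  have discr: "discrete_at k (G n)" for n
  proof (induction n)
    case (Suc n)
    have "x = y" if xG: "x \<in> G (Suc n)" "y \<in> G (Suc n)" "near k x y" for x y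
    proof -
      have xy: "x \<in> space X" "y \<in> space X" "near k y x"
        using that sp near_sym by blast+
      consider "x \<in> G n" "y \<in> G n" | "x \<in> W n" "y \<in> W n" | "x \<in> G n" "y \<notin> thick k (G n)"
        | "y \<in> G n" "x \<notin> thick k (G n)"
        using xG by (auto simp: GS)
      then show ?thesis
      proof cases
        case 1 then show ?thesis using Suc that by (auto simp: discrete_at_def)
      next
        case 2 then show ?thesis using that(3) xy act_zero by (auto simp: W_def near_def)
      next
        case 3 then show ?thesis using xy by (auto simp: thick_iff)
      next
        case 4 then show ?thesis using that(3) xy by (auto simp: thick_iff)
      qed
    qed
    then show ?case by (auto simp: discrete_at_def)
  qed (simp add: G0 discrete_at_def)
  show ?thesis
  proof (intro bexI[of _ "\<Union>n. G n"] conjI)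
    show "(\<Union>n. G n) \<in> sets X" using G by auto
    show "(\<Union>n. G n) \<subseteq> Y" using GY by auto
    show "discrete_at k (\<Union>n. G n)"
      unfolding discrete_at_def
    proof (intro ballI impI)
      fix x y assume "x \<in> (\<Union>n. G n)" "y \<in> (\<Union>n. G n)" and n: "near k x y"
      then obtain a b where "x \<in> G a" "y \<in> G b" by auto
      then have "x \<in> G (max a b)" "y \<in> G (max a b)"
        using monoD[OF \<open>mono G\<close>, of _ "max a b"] by (meson max.cobounded1 max.cobounded2 subsetD)+
      then show "x = y" using discr n by (auto simp: discrete_at_def)
    qed
    show "Y \<subseteq> thick k (\<Union>n. G n)"
    proof
      fix x assume x: "x \<in> Y"
      then have xs: "x \<in> space X" using sets.sets_into_space[OF Y] by auto
      \<comment> \<open>The punctured ball around \<open>x\<close>; freeness keeps \<open>x\<close>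
        itself out of it.\<close>
      define F where "F = (\<lambda>v. act v x) ` (ibox k - {0})"
      have "F \<subseteq> space X - {x}"
      proof
        fix y assume "y \<in> F"
        then obtain v where v: "v \<in> ibox k" "v \<noteq> 0" "y = act v x" by (auto simp: F_def)
        then have "y \<noteq> x" using act_free[OF xs] ibox_support by metis
        then show "y \<in> space X - {x}" using v xs by simp
      qed
      then obtain n where n: "x \<in> U n" "U n \<inter> F = {}"
        using sep[OF xs, of F] by (auto simp: F_def)
      then have "x \<in> W n" using x by (auto simp: W_def F_def)
      then consider "x \<in> G (Suc n)" | "x \<in> thick k (G n)" by (auto simp: GS)
      then show "x \<in> thick k (\<Union>n. G n)"
      proof cases
        case 1 then show ?thesis
          using subset_thick[OF sp[of "Suc n"], of k] thick_mono[of "G (Suc n)" "\<Union>n. G n" k k] by blast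
      next
        case 2 then show ?thesis using thick_mono[of "G n" "\<Union>n. G n" k k] by blast
      qed
    qed
  qed
qed

text \<open>Pigeonhole: the box of radius \<open>20 * R\<close> is cut into cells of side
  \<open>R\<close>, and two points in the same cell are within \<open>R\<close> of each
  other.\<close>

lemma packing_bound:
  fixes C :: nat
  assumes x: "x \<in> space X" and R: "R > 0"
    and f: "\<And>j. j < C \<Longrightarrow> near (20 * R) x (f j)"
    and sep: "\<And>i j. i < j \<Longrightarrow> j < C \<Longrightarrow> \<not> near R (f i) (f j)"
  shows "C \<le> 41 ^ d"
proof -
  have "\<exists>v\<in>ibox (20 * R). act v x = f j" if "j < C" for j
    using f[OF that] by (simp add: near_def)
  then obtain v where v: "\<And>j. j < C \<Longrightarrow> v j \<in> ibox (20 * R) \<and> act (v j) x = f j"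
    by metis
  \<comment> \<open>The shifted coordinates run from 0 to \<open>40 * R\<close> with both ends
    included, hence 41 quotients per axis.\<close>
  define cell where "cell j = (\<lambda>i\<in>{..<d}. (v j i + 20 * int R) div int R)" for j
  have "inj_on cell {..<C}"
  proof (rule linorder_inj_onI')
    fix i j assume ij: "i < j" "i \<in> {..<C}" "j \<in> {..<C}"
    show "cell i \<noteq> cell j"
    proof
      assume eq: "cell i = cell j"
      have "v j - v i \<in> ibox R"
      proof -
        have "\<bar>v j l - v i l\<bar> \<le> int R" if "l < d" for l
        proof -
          have e: "(v i l + 20 * int R) div int R = (v j l + 20 * int R) div int R"
            using fun_cong[OF eq, of l] that by (simp add: cell_def)
          define a b where "a = v i l + 20 * int R" and "b = v j l + 20 * int R"
          have "a = int R * (a div int R) + a mod int R" "b = int R * (b div int R) + b mod int R"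
            by auto
          moreover have "0 \<le> a mod int R" "a mod int R < int R" "0 \<le> b mod int R" "b mod int R < int R"
            using R by auto
          moreover have "a div int R = b div int R"
            using e by (simp add: a_def b_def)
          ultimately have "\<bar>b - a\<bar> \<le> int R"
            by (smt (verit))
          then show ?thesis by (simp add: a_def b_def)
        qed
        moreover have "v j l - v i l = 0" if "l \<ge> d" for l
          using v[of i] v[of j] ij that by (auto simp: ibox_def)
        ultimately have "\<bar>v j l - v i l\<bar> \<le> int R" for l
          by (cases "l < d") auto
        then show ?thesis
          using \<open>\<And>l. l \<ge> d \<Longrightarrow> v j l - v i l = 0\<close> by (simp add: ibox_def)
      qed
      moreover have "act (v j - v i) (f i) = f j"
      proof -
        have "act (v j - v i) (act (v i) x) = act ((v j - v i) + v i) x"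
          using x by (simp only: act_add)
        then show ?thesis using v[of i] v[of j] ij by simp
      qed
      ultimately have "near R (f i) (f j)" by (auto simp: near_def)
      then show False using sep ij by auto
    qed
  qed
  moreover have "cell ` {..<C} \<subseteq> {..<d} \<rightarrow>\<^sub>E {0..40}"
  proof
    fix c assume "c \<in> cell ` {..<C}"
    then obtain j where j: "j < C" "c = cell j" by auto
    have "(v j i + 20 * int R) div int R \<in> {0..40}" for i
    proof -
      have "\<bar>v j i\<bar> \<le> 20 * int R" using v[OF j(1)] by (auto simp: ibox_def)
      define a where "a = v j i + 20 * int R"
      have "0 \<le> a" "a \<le> 40 * int R"
        using \<open>\<bar>v j i\<bar> \<le> 20 * int R\<close> by (auto simp: a_def)
      then have "0 \<le> a div int R" "a div int R \<le> (40 * int R) div int R"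
        using R zdiv_mono1[of a "40 * int R" "int R"] by (simp_all add: pos_imp_zdiv_nonneg_iff)
      then show ?thesis using R by (simp add: a_def)
    qed
    then show "c \<in> {..<d} \<rightarrow>\<^sub>E {0..40}" using j by (auto simp: cell_def)
  qed
  ultimately have "card {..<C} \<le> card ({..<d} \<rightarrow>\<^sub>E {0..40::int})"
    by (intro card_inj_on_le) (auto intro: finite_PiE)
  then show ?thesis by (simp add: card_PiE)
qed

text \<open>Each colour is a maximal discrete subset of what the earlier colours leave uncovered. A
  point missed by \<open>41 ^ d + 1\<close> rounds would have a marker of every round within
  \<open>20 * R\<close>, and these are pairwise more than \<open>R\<close> apart, against
  \<open>packing_bound\<close>.\<close>

lemma coloured_cover:
  assumes R: "R > 0"
  shows "\<exists>M :: nat \<Rightarrow> 'a set. (\<forall>j. M j \<in> sets X \<and> discrete_at (20 * R) (M j)) \<and>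
    (\<forall>x\<in>space X. \<exists>j\<le>41 ^ d. x \<in> thick R (M j))"
proof -
  obtain mis where mis: "\<And>Y. Y \<in> sets X \<Longrightarrow> mis Y \<in> sets X \<and> mis Y \<subseteq> Y \<and> discrete_at (20 * R) (mis Y)
      \<and> Y \<subseteq> thick (20 * R) (mis Y)"
    using maximal_discrete[of _ "20 * R"] by metis
  define cov where "cov = rec_nat {} (\<lambda>n S. S \<union> thick R (mis (space X - S)))"
  define M where "M j = mis (space X - cov j)" for j :: nat
  have cov0: "cov 0 = {}" and covS: "cov (Suc j) = cov j \<union> thick R (M j)" for j
    by (auto simp: cov_def M_def)
  have cov: "cov j \<in> sets X" for j
    by (induction j) (auto simp: cov0 covS M_def intro!: sets_thick mis[THEN conjunct1])
  have M: "M j \<in> sets X" "M j \<subseteq> space X - cov j" "discrete_at (20 * R) (M j)"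
    "space X - cov j \<subseteq> thick (20 * R) (M j)" for j
    using mis[of "space X - cov j"] cov by (auto simp: M_def)
  have "mono cov"
    unfolding mono_iff_le_Suc by (auto simp: covS)
  have "\<exists>j\<le>41 ^ d. x \<in> thick R (M j)" if x: "x \<in> space X" for x
  proof (rule ccontr)
    assume neg: "\<not> ?thesis"
    have "x \<notin> cov j" if "j \<le> Suc (41 ^ d)" for j
      using that neg by (induction j) (auto simp: cov0 covS)
    then have "x \<in> thick (20 * R) (M j)" if "j < Suc (41 ^ d)" for j
      using M(4) x that by (meson DiffI less_imp_le subsetD)
    then have "\<exists>m\<in>M j. near (20 * R) x m" if "j < Suc (41 ^ d)" for j
      using that by (auto simp: thick_iff)
    then obtain f where f: "\<And>j. j < Suc (41 ^ d) \<Longrightarrow> f j \<in> M j \<and> near (20 * R) x (f j)"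
      by metis
    have "Suc (41 ^ d) \<le> 41 ^ d"
    proof (rule packing_bound[OF x R])
      fix i j :: nat assume ij: "i < j" "j < Suc (41 ^ d)"
      have "thick R (M i) \<subseteq> cov j"
        using monoD[OF \<open>mono cov\<close>, of "Suc i" j] ij by (auto simp: covS)
      moreover have "f j \<in> space X - cov j" "f i \<in> M i"
        using f[of j] f[of i] M(2) ij by auto
      ultimately have "\<not> near R (f j) (f i)"
        unfolding thick_iff subset_iff by blast
      then show "\<not> near R (f i) (f j)"
        using near_sym M(2) \<open>f i \<in> M i\<close> by blast
    qed (use f in auto)
    then show False by simp
  qed
  then show ?thesis using M by (intro exI[of _ M]) auto
qed

subsection \<open>Separated marker sets that cover every orbit\<close>

text \<open>At each scale the whole space is covered by a number of colours that does not depend on the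
  scale, so on every orbit some colour is used at infinitely many scales. Fixing the least such
  colour on each orbit leaves one colour per scale, hence far apart markers.\<close>

lemma covering_markers:
  fixes R :: "nat \<Rightarrow> nat"
  assumes R: "\<And>n. n < R n"
  shows "\<exists>M. (\<forall>n. M n \<in> sets X \<and> discrete_at (20 * R n) (M n)) \<and>
    (\<forall>x\<in>space X. \<exists>n. x \<in> thick (2 * R n) (M n))"
proof -
  have "\<forall>n. \<exists>M :: nat \<Rightarrow> 'a set. (\<forall>j. M j \<in> sets X \<and> discrete_at (20 * R n) (M j)) \<and>
      (\<forall>x\<in>space X. \<exists>j\<le>41 ^ d. x \<in> thick (R n) (M j))"
    using coloured_cover R by (metis gr_zeroI not_less_zero)
  then obtain N :: "nat \<Rightarrow> nat \<Rightarrow> 'a set" where N: "\<And>n j. N n j \<in> sets X"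
    "\<And>n j. discrete_at (20 * R n) (N n j)"
    and cover: "\<And>n x. x \<in> space X \<Longrightarrow> \<exists>j\<le>41 ^ d. x \<in> thick (R n) (N n j)"
    by metis
  \<comment> \<open>Colour \<open>j\<close> covers some point of the orbit at arbitrarily large
    scales. Letting that point differ from \<open>x\<close> makes the condition
    orbit-invariant.\<close>
  define J where "J j x \<longleftrightarrow> (\<exists>k. \<exists>v\<in>ibox k. \<forall>a. \<exists>n. n \<ge> a \<and> act v x \<in> thick (R n) (N n j))" for j x
  have J_sets: "{x \<in> space X. J j x} \<in> sets X" for j
    unfolding J_def
    by (intro sets.sets_Collect_countable_Ex sets.sets_Collect_finite_Ex sets.sets_Collect_countable_All
        sets.sets_Collect_conj sets.sets_Collect_const sets_act sets_thick N finite_ibox)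
  have J_near: "J j y" if xy: "x \<in> space X" "near k x y" "J j x" for j k x y
  proof -
    obtain u where u: "u \<in> ibox k" "y = act u x" using xy(2) by (auto simp: near_def)
    obtain l v where v: "v \<in> ibox l" "\<And>a. \<exists>n. n \<ge> a \<and> act v x \<in> thick (R n) (N n j)"
      using xy(3) by (auto simp: J_def)
    have "act (v + - u) y = act v x"
      using u xy(1) by (simp only: act_add act_space act_minus_act)
    moreover have "v + - u \<in> ibox (l + k)"
      using u v by (intro add_in_ibox) auto
    ultimately show ?thesis using v(2) unfolding J_def by metis
  qed
  define L where "L j x \<longleftrightarrow> J j x \<and> (\<forall>i<j. \<not> J i x)" for j x
  have L_sets: "{x \<in> space X. L j x} \<in> sets X" for j
    unfolding L_def
    by (intro sets.sets_Collect_conj sets.sets_Collect_countable_All sets.sets_Collect_imp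
        sets.sets_Collect_neg sets.sets_Collect_const J_sets)
  have L_near: "L j y" if "x \<in> space X" "near k x y" "L j x" for j k x y
    using that J_near[OF that(1,2)] J_near[OF near_space[OF that(2,1)] near_sym[OF that(1,2)]]
    unfolding L_def by blast
  have L_unique: "i = j" if "L i x" "L j x" for i j x
    using that unfolding L_def by (metis linorder_neqE_nat)
  define M where "M n = {x \<in> space X. \<exists>j. L j x \<and> x \<in> N n j}" for n
  have "M n \<in> sets X" for n
  proof -
    have "M n = (\<Union>j. {x \<in> space X. L j x} \<inter> N n j)"
      by (auto simp: M_def)
    then show ?thesis using L_sets N by auto
  qed
  moreover have "discrete_at (20 * R n) (M n)" for n
    unfolding discrete_at_def
  proof (intro ballI impI)
    fix x y assume "x \<in> M n" "y \<in> M n" and xy: "near (20 * R n) x y"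
    then obtain i j where x: "x \<in> space X" "L i x" "x \<in> N n i" and y: "L j y" "y \<in> N n j"
      by (auto simp: M_def)
    \<comment> \<open>Nearby points share an orbit and hence the selected colour, so discreteness of
      that single colour applies.\<close>
    have "i = j" using L_unique L_near[OF x(1) xy x(2)] y(1) by blast
    then show "x = y" using N(2)[of n i] x y xy by (auto simp: discrete_at_def)
  qed
  moreover have "\<exists>n. x \<in> thick (2 * R n) (M n)" if x: "x \<in> space X" for x
  proof -
    have "\<exists>j. J j x"
    proof (rule ccontr)
      assume "\<not> ?thesis"
      then have "\<exists>a. \<forall>n\<ge>a. x \<notin> thick (R n) (N n j)" for j
        using act_zero[OF x] zero_in_ibox unfolding J_def by metis
      then obtain a where a: "\<And>j n. n \<ge> a j \<Longrightarrow> x \<notin> thick (R n) (N n j)" by metis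
      have "a j \<le> Max (a ` {..41 ^ d})" if "j \<le> 41 ^ d" for j
        using that by (intro Max_ge) auto
      then show False using a cover[OF x] by blast
    qed
    then have "L (LEAST j. J j x) x"
      unfolding L_def using LeastI_ex not_less_Least by metis
    then obtain j where j: "L j x" by blast
    then obtain k v where v: "v \<in> ibox k" "\<And>a. \<exists>n. n \<ge> a \<and> act v x \<in> thick (R n) (N n j)"
      by (auto simp: L_def J_def)
    \<comment> \<open>The displacement \<open>k\<close> is fixed while the scales grow: for
      \<open>n \<ge> k\<close> it is below \<open>R n\<close>, so that doubling the radius pays for
      it.\<close>
    obtain n where n: "n \<ge> k" "act v x \<in> thick (R n) (N n j)" using v(2) by blast
    have "near (R n) (act v x) x"
      using near_mono[OF near_sym[OF x near_act[OF v(1)]]] n(1) R[of n] by simp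
    then have "x \<in> thick (2 * R n) (N n j)"
      using near_thick[OF n(2)] by simp
    then obtain m where m: "m \<in> N n j" "near (2 * R n) x m" by (auto simp: thick_iff)
    then have "m \<in> M n"
      using L_near[OF x m(2) j] near_space[OF m(2) x] by (auto simp: M_def)
    then show ?thesis using m x by (auto simp: thick_iff)
  qed
  ultimately show ?thesis by metis
qed

subsection \<open>Nested finite regions with well separated boundaries\<close>

text \<open>Every region of level \<open>k\<close> that comes within \<open>R k\<close> of \<open>S\<close> is added to \<open>S\<close> together with a margin
  \<open>\<tau>\<close>. Levels are absorbed downwards: what the lower levels add afterwards is too small to reach
  the regions of level \<open>k\<close> that were left out.\<close>

definition absorb :: "nat \<Rightarrow> (nat \<Rightarrow> nat) \<Rightarrow> (nat \<Rightarrow> 'a set) \<Rightarrow> nat \<Rightarrow> 'a set \<Rightarrow> 'a set" where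
  "absorb \<tau> R P k S = S \<union> thick \<tau> (P k \<inter> thick (8 * R k) (P k \<inter> thick (R k) S))"

primrec absorbs :: "nat \<Rightarrow> (nat \<Rightarrow> nat) \<Rightarrow> (nat \<Rightarrow> 'a set) \<Rightarrow> nat \<Rightarrow> 'a set \<Rightarrow> 'a set" where
  "absorbs \<tau> R P 0 S = S"
| "absorbs \<tau> R P (Suc k) S = absorbs \<tau> R P k (absorb \<tau> R P k S)"

text \<open>Only earlier levels are read, which lets the regions be defined by recursion on the
  level.\<close>

lemma absorbs_cong: "(\<And>l. l < k \<Longrightarrow> P l = P' l) \<Longrightarrow> absorbs \<tau> R P k S = absorbs \<tau> R P' k S"
  by (induction k arbitrary: S) (auto simp: absorb_def)

lemma absorb_sets: "P k \<in> sets X \<Longrightarrow> S \<in> sets X \<Longrightarrow> absorb \<tau> R P k S \<in> sets X"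
  unfolding absorb_def by (intro sets.Un sets.Int sets_thick)

lemma absorbs_sets:
  "(\<And>l. l < k \<Longrightarrow> P l \<in> sets X) \<Longrightarrow> S \<in> sets X \<Longrightarrow> absorbs \<tau> R P k S \<in> sets X"
  by (induction k arbitrary: S) (auto intro!: absorb_sets)

lemma absorb_space: "S \<subseteq> space X \<Longrightarrow> absorb \<tau> R P k S \<subseteq> space X"
  using thick_space by (auto simp: absorb_def)

lemma subset_absorbs: "S \<subseteq> absorbs \<tau> R P k S"
proof (induction k arbitrary: S)
  case (Suc k)
  have "S \<subseteq> absorb \<tau> R P k S" by (simp add: absorb_def)
  then show ?case using Suc[of "absorb \<tau> R P k S"] by simp
qed simp

lemma absorb_growth:
  assumes "S \<subseteq> space X" shows "absorb \<tau> R P k S \<subseteq> thick (9 * R k + \<tau>) S"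
proof
  fix x assume "x \<in> absorb \<tau> R P k S"
  then consider "x \<in> S" | "x \<in> thick \<tau> (thick (8 * R k) (thick (R k) S))"
    unfolding absorb_def
    using thick_mono[of "P k \<inter> thick (8 * R k) (P k \<inter> thick (R k) S)" "thick (8 * R k) (thick (R k) S)"]
      thick_mono[of "P k \<inter> thick (R k) S" "thick (R k) S"] by blast
  then show "x \<in> thick (9 * R k + \<tau>) S"
  proof cases
    case 1 then show ?thesis using subset_thick[OF assms] by blast
  next
    case 2
    then have "x \<in> thick (\<tau> + 8 * R k) (thick (R k) S)" by (rule thick_thick) simp
    then show ?thesis by (rule thick_thick) simp
  qed
qed

lemma absorbs_growth:
  "S \<subseteq> space X \<Longrightarrow> absorbs \<tau> R P k S \<subseteq> thick (\<Sum>l<k. 9 * R l + \<tau>) S"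
proof (induction k arbitrary: S)
  case 0 then show ?case using subset_thick by simp
next
  case (Suc k)
  have "absorbs \<tau> R P (Suc k) S \<subseteq> thick (\<Sum>l<k. 9 * R l + \<tau>) (absorb \<tau> R P k S)"
    using Suc.IH[OF absorb_space[OF Suc.prems]] by simp
  also have "\<dots> \<subseteq> thick (\<Sum>l<k. 9 * R l + \<tau>) (thick (9 * R k + \<tau>) S)"
    using absorb_growth[OF Suc.prems] by (intro thick_mono) auto
  also have "\<dots> \<subseteq> thick (\<Sum>l<Suc k. 9 * R l + \<tau>) S"
    using thick_thick by auto
  finally show ?case .
qed

text \<open>The markers of \<open>a\<close> and \<open>b\<close> are within
  \<open>(3 + 14 + 3) * R\<close> of each other and therefore equal. Thus the
  \<open>3 * R\<close>-neighbourhood of \<open>M\<close> splits into clusters of diameter at most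
  \<open>6 * R\<close>, more than \<open>14 * R\<close> apart, and the radius \<open>8 * R k\<close>
  in \<open>absorb\<close> always catches whole clusters.\<close>

lemma same_centre:
  assumes "discrete_at (20 * R) M" "M \<subseteq> space X" "a \<in> thick (3 * R) M" "b \<in> thick (3 * R) M"
    "near (14 * R) a b"
  shows "near (6 * R) a b"
proof -
  obtain m m' where m: "a \<in> space X" "m \<in> M" "near (3 * R) a m" "m' \<in> M" "near (3 * R) b m'"
    "b \<in> space X"
    using assms by (auto simp: thick_iff)
  have "near (3 * R) m a" using near_sym[OF m(1,3)] .
  then have "near (17 * R) m b"
    using near_trans[of m "3 * R" a "14 * R" b] assms(2,5) m(2) by auto
  then have "near (20 * R) m m'"
    using near_trans[of m "17 * R" b "3 * R" m'] assms(2) m(2,5) by auto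
  then have "m = m'" using assms(1) m by (auto simp: discrete_at_def)
  then show ?thesis
    using near_trans[OF m(1,3)] near_sym[OF m(6,5)] by simp
qed

text \<open>At the moment when level \<open>k\<close> is treated, a cluster of \<open>P k\<close> is
  either absorbed with margin \<open>\<tau>\<close> or is farther than \<open>R k\<close> from
  \<open>S\<close>. In the second case the later growth, bounded by the sum in the hypothesis,
  cannot bring the set within reach of it.\<close>

lemma absorbs_all_or_nothing:
  assumes "k < n" "S \<subseteq> space X" "M \<subseteq> space X" "discrete_at (20 * R k) M" "P k \<subseteq> thick (3 * R k) M"
    and g: "(\<Sum>l<k. 9 * R l + \<tau>) + 5 * \<tau> \<le> R k"
    and "y \<in> thick \<tau> (P k)" "y \<in> thick \<tau> (absorbs \<tau> R P n S)"
  shows "y \<in> absorbs \<tau> R P n S"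
  using assms(1,2,8)
proof (induction n arbitrary: S)
  case (Suc n)
  define S' where "S' = absorb \<tau> R P n S"
  have S': "S' \<subseteq> space X" using absorb_space Suc.prems(2) by (simp add: S'_def)
  show ?case
  proof (cases "k < n")
    case True
    then show ?thesis using Suc.IH[OF True S'] Suc.prems by (simp add: S'_def)
  next
    case False
    then have n: "n = k" using Suc.prems by simp
    define g where "g = (\<Sum>l<k. 9 * R l + \<tau>)"
    have gk: "g + 5 * \<tau> \<le> R k" using g by (simp add: g_def)
    have y: "y \<in> space X" using assms(7) by (auto simp: thick_iff)
    obtain x where x: "x \<in> P k" "near \<tau> y x" using assms(7) by (auto simp: thick_iff)
    have xs: "x \<in> space X" using near_space x(2) y by blast
    \<comment> \<open>Everything added after level \<open>k\<close> comes from levels below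
      \<open>k\<close>.\<close>
    have "absorbs \<tau> R P (Suc n) S \<subseteq> thick g S'"
      using absorbs_growth[OF S'] n by (simp add: S'_def g_def)
    then have "y \<in> thick \<tau> (thick g S')"
      using Suc.prems(3) thick_mono by blast
    then have "y \<in> thick (g + \<tau>) S'" by (rule thick_thick) simp
    then have "x \<in> thick (g + 2 * \<tau>) S'"
      using near_thick x(2) by (metis add.assoc mult_2 order_refl)
    then obtain s where s: "s \<in> S'" "near (g + 2 * \<tau>) x s" by (auto simp: thick_iff)
    define W where "W = P k \<inter> thick (R k) S"
    have "x \<in> thick (8 * R k) W"
    proof (cases "s \<in> S")
      case True
      then have "x \<in> thick (R k) S"
        using near_mono[OF s(2), of "R k"] gk xs by (auto simp: thick_iff)
      then have "x \<in> W" using x by (simp add: W_def)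
      then show ?thesis using xs near_refl[OF xs] unfolding thick_iff by blast
    next
      case False
      then obtain x' where x': "x' \<in> P k" "x' \<in> thick (8 * R k) W" "near (\<tau>) s x'"
        using s(1) n by (auto simp: S'_def absorb_def W_def thick_iff)
      then obtain w where w: "w \<in> W" "near (8 * R k) x' w" by (auto simp: thick_iff)
      have "near (R k) x x'"
        using near_trans[OF xs s(2) x'(3)] gk by simp
      then have "near (9 * R k) x w"
        using near_trans[OF xs _ w(2)] by simp
      \<comment> \<open>\<open>same_centre\<close> shortens the detour through \<open>x'\<close> to
        less than the \<open>8 * R k\<close> allowed in \<open>absorb\<close>.\<close>
      then have "near (6 * R k) x w"
        using assms(3-5) x(1) w(1) by (intro same_centre) (auto simp: W_def intro: near_mono)
      then show ?thesis using xs w(1) near_mono[of "6 * R k" x w "8 * R k"] by (auto simp: thick_iff)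
    qed
    then have "y \<in> thick \<tau> (P k \<inter> thick (8 * R k) W)"
      using x y unfolding thick_iff[of y] by blast
    then have "y \<in> S'" by (simp add: S'_def absorb_def W_def n)
    then show ?thesis using subset_absorbs[of S' \<tau> R P n] by (auto simp: S'_def)
  qed
qed simp

text \<open>Start from the covering neighbourhoods \<open>Q n\<close> of the markers and absorb the
  regions of lower levels. The total growth is at most \<open>R n\<close>, which turns the radius
  \<open>2 * R n\<close> into \<open>3 * R n\<close>.\<close>

lemma nested_regions_exist:
  assumes \<tau>: "\<tau> > 0"
  shows "\<exists>(R :: nat \<Rightarrow> nat) (M :: nat \<Rightarrow> 'a set) P. (\<forall>n. \<tau> \<le> R n \<and> M n \<in> sets X \<and> P n \<in> sets X \<and> discrete_at (20 * R n) (M n) \<and>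
      P n \<subseteq> thick (3 * R n) (M n)) \<and>
    (\<forall>k n. k < n \<longrightarrow> thick \<tau> (P k) \<inter> thick \<tau> (P n) \<subseteq> P n) \<and>
    (\<forall>x\<in>space X. \<exists>n. x \<in> P n)"
proof -
  \<comment> \<open>Geometric growth with a ratio large enough for the recursion: level
    \<open>k\<close> adds \<open>9 * R k + \<tau>\<close> to a sum already below
    \<open>R k\<close>.\<close>
  define R where "R n = 5 * \<tau> * 20 ^ n" for n
  have g: "(\<Sum>l<k. 9 * R l + \<tau>) + 5 * \<tau> \<le> R k" for k
  proof (induction k)
    case (Suc k)
    have "5 * \<tau> \<le> R k" by (simp add: R_def)
    moreover have "R (Suc k) = 20 * R k" by (simp add: R_def)
    ultimately show ?case using Suc by simp
  qed (simp add: R_def)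
  have "n < R n" for n
  proof -
    have "n < 20 ^ n" by (rule less_exp[THEN order.strict_trans2]) (simp add: power_mono)
    also have "\<dots> \<le> R n" using \<tau> by (simp add: R_def)
    finally show ?thesis .
  qed
  then obtain M where M: "\<And>n. M n \<in> sets X" "\<And>n. discrete_at (20 * R n) (M n)"
    and cover: "\<And>x. x \<in> space X \<Longrightarrow> \<exists>n. x \<in> thick (2 * R n) (M n)"
    using covering_markers[of R] by blast
  define Q where "Q n = thick (2 * R n) (M n)" for n
  have Q: "Q n \<in> sets X" "Q n \<subseteq> space X" for n
    using M thick_space by (auto simp: Q_def intro: sets_thick)
  \<comment> \<open>\<open>H n\<close> is the table of the regions of levels below \<open>n\<close>,
    empty elsewhere.\<close>
  define H where "H = rec_nat (\<lambda>_. {}) (\<lambda>n P. P(n := absorbs \<tau> R P n (Q n)))"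
  have HS: "H (Suc n) = (H n)(n := absorbs \<tau> R (H n) n (Q n))" for n
    by (simp add: H_def)
  define P where "P n = H (Suc n) n" for n
  have "H n k = P k" if "k < n" for n k
    using that by (induction n) (auto simp: HS P_def less_Suc_eq)
  then have P: "P n = absorbs \<tau> R P n (Q n)" for n
    by (simp add: P_def HS) (rule absorbs_cong, simp add: P_def HS)
  have Ps: "P n \<in> sets X" for n
  proof (induction n rule: less_induct)
    case (less n)
    then show ?case by (subst P) (intro absorbs_sets Q)
  qed
  have P3: "P n \<subseteq> thick (3 * R n) (M n)" for n
  proof
    fix x assume "x \<in> P n"
    then have "x \<in> thick (\<Sum>l<n. 9 * R l + \<tau>) (Q n)"
      using absorbs_growth[OF Q(2)] P by blast
    then show "x \<in> thick (3 * R n) (M n)"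
      unfolding Q_def by (rule thick_thick) (use g[of n] in simp)
  qed
  have nest: "y \<in> P n" if "k < n" "y \<in> thick \<tau> (P k)" "y \<in> thick \<tau> (P n)" for k n y
    using absorbs_all_or_nothing[where P = P, OF that(1) Q(2)[of n] sets.sets_into_space[OF M(1)[of k]] M(2)[of k] P3[of k] g[of k] that(2)]
      that(3) P[of n] by simp
  have "\<exists>n. x \<in> P n" if "x \<in> space X" for x
    using cover[OF that] subset_absorbs P unfolding Q_def by blast
  moreover have "\<tau> \<le> R n" for n by (simp add: R_def)
  ultimately have "(\<forall>n. \<tau> \<le> R n \<and> M n \<in> sets X \<and> P n \<in> sets X \<and> discrete_at (20 * R n) (M n) \<and>
      P n \<subseteq> thick (3 * R n) (M n)) \<and>
    (\<forall>k n. k < n \<longrightarrow> thick \<tau> (P k) \<inter> thick \<tau> (P n) \<subseteq> P n) \<and> (\<forall>x\<in>space X. \<exists>n. x \<in> P n)"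
    using M Ps P3 nest by auto
  then show ?thesis by blast
qed

end

subsection \<open>Sparse walls\<close>

text \<open>Base 5 with digits from -2 to 2: the extreme value is
  \<open>(5 ^ n - 1) / 2\<close>.\<close>

lemma balanced_digits_bound:
  fixes w :: "nat \<Rightarrow> int"
  assumes "\<And>j. j < n \<Longrightarrow> \<bar>w j\<bar> \<le> 2"
  shows "2 * \<bar>\<Sum>j<n. 5 ^ j * w j\<bar> < 5 ^ n"
  using assms
proof (induction n)
  case (Suc n)
  have "\<bar>5 ^ n * w n\<bar> \<le> 5 ^ n * 2"
    using Suc.prems[of n] by (simp add: abs_mult)
  moreover have "2 * \<bar>\<Sum>j<n. 5 ^ j * w j\<bar> < 5 ^ n"
    using Suc by simp
  moreover have "\<bar>\<Sum>j<Suc n. 5 ^ j * w j\<bar> \<le> \<bar>\<Sum>j<n. 5 ^ j * w j\<bar> + \<bar>5 ^ n * w n\<bar>"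
    by (simp add: abs_triangle_ineq)
  ultimately show ?case
    unfolding power_Suc by linarith
qed simp

text \<open>Modulo 5 only the lowest digit survives, so it vanishes; divide by 5 and repeat.\<close>

lemma balanced_digits_zero:
  fixes w :: "nat \<Rightarrow> int"
  assumes "\<And>j. j < n \<Longrightarrow> \<bar>w j\<bar> \<le> 2" "(\<Sum>j<n. 5 ^ j * w j) = 0" "i < n"
  shows "w i = 0"
  using assms
proof (induction n arbitrary: w i)
  case (Suc n)
  have "(\<Sum>j<Suc n. 5 ^ j * w j) = w 0 + 5 * (\<Sum>j<n. 5 ^ j * w (Suc j))"
    by (simp add: sum.lessThan_Suc_shift sum_distrib_left mult.assoc del: sum.lessThan_Suc)
  then have eq: "w 0 = 5 * - (\<Sum>j<n. 5 ^ j * w (Suc j))"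
    using Suc.prems(2) by simp
  then have w0: "w 0 = 0"
    using Suc.prems(1)[of 0] by presburger
  then have "w (Suc j) = 0" if "j < n" for j
    using Suc.IH[of "\<lambda>j. w (Suc j)" j] Suc.prems(1) eq that by simp
  then show ?case using w0 Suc.prems(3) by (cases i) auto
qed simp

definition unit_vec :: "nat \<Rightarrow> int \<Rightarrow> nat \<Rightarrow> int" where
  "unit_vec i k = (\<lambda>j. if j = i then k else 0)"

text \<open>Advancing in direction \<open>i\<close> by one raises this form by one, while no nonzero vector with entries
  of absolute value at most 2 is a zero of it modulo \<open>5 ^ Suc d\<close>. Hence the blocks of length
  \<open>5 ^ Suc d\<close> that it cuts out of the lines in direction \<open>i\<close> have pairwise distant endpoints.\<close>

definition slant :: "nat \<Rightarrow> nat \<Rightarrow> (nat \<Rightarrow> int) \<Rightarrow> int" where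
  "slant d i v = (\<Sum>j<Suc d. 5 ^ j * (case j of 0 \<Rightarrow> v i | Suc l \<Rightarrow> if l = i then 0 else v l))"

lemma slant_add: "slant d i (u + v) = slant d i u + slant d i v"
  unfolding slant_def sum.distrib[symmetric]
  by (intro sum.cong) (auto simp: algebra_simps split: nat.split)

lemma slant_unit_vec: "slant d i (unit_vec i k) = k"
  unfolding slant_def
  by (subst sum.lessThan_Suc_shift) (auto simp: unit_vec_def intro!: sum.neutral)

text \<open>The entries of \<open>u\<close> are the balanced base-5 digits of the form:
  \<open>u i\<close> in the lowest place, each other \<open>u l\<close> in place
  \<open>Suc l\<close>, and place \<open>Suc i\<close> blank. The value is smaller than the modulus,
  so divisibility makes it zero.\<close>

lemma slant_dvd_imp_zero:
  assumes "\<And>j. \<bar>u j\<bar> \<le> 2" "i < d" "5 ^ Suc d dvd slant d i u" "j < d"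
  shows "u j = 0"
proof -
  define w where "w j = (case j of 0 \<Rightarrow> u i | Suc l \<Rightarrow> if l = i then 0 else u l)" for j
  have w: "\<bar>w j\<bar> \<le> 2" for j
    using assms(1) by (auto simp: w_def split: nat.split)
  have "\<bar>slant d i u\<bar> < 5 ^ Suc d"
    using balanced_digits_bound[of "Suc d" w, OF w] unfolding slant_def w_def[symmetric] by linarith
  then have "slant d i u = 0"
    using dvd_imp_le_int[OF _ assms(3)] by (cases "slant d i u = 0") auto
  then have "w l = 0" if "l < Suc d" for l
    using balanced_digits_zero[of "Suc d" w l, OF w] that unfolding slant_def w_def[symmetric] by blast
  from this[of 0] this[of "Suc j"] show ?thesis
    using assms by (cases "j = i") (auto simp: w_def)
qed

lemma div_eq_imp_abs_less:
  fixes a k b :: int assumes "(a + k) div b = a div b" "b > 0" shows "\<bar>k\<bar> < b"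
proof -
  have "a = b * (a div b) + a mod b" "a + k = b * ((a + k) div b) + (a + k) mod b"
    by auto
  moreover have "0 \<le> a mod b" "a mod b < b" "0 \<le> (a + k) mod b" "(a + k) mod b < b"
    using assms by auto
  ultimately show ?thesis using assms(1) by (smt (verit))
qed

lemma div_succ_neq_imp_dvd:
  fixes a b :: int assumes "(a + 1) div b \<noteq> a div b" "b > 0" shows "b dvd a + 1"
proof (rule ccontr)
  assume neg: "\<not> b dvd a + 1"
  have r: "0 \<le> a mod b" "a mod b < b" using assms by auto
  have "a + 1 = b * (a div b) + (a mod b + 1)" by auto
  moreover from this neg have "a mod b + 1 \<noteq> b"
    by (metis dvd_add_right_iff dvd_refl dvd_triv_left)
  ultimately have "(a + 1) div b = a div b"
    using r by (intro int_div_pos_eq[of _ _ _ "a mod b + 1"]) auto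
  then show False using assms by simp
qed

section \<open>Local coordinates, slanted regions and their parities\<close>

locale nested_regions = free_Zd_action +
  fixes \<tau> :: nat and R :: "nat \<Rightarrow> nat" and M P :: "nat \<Rightarrow> 'a set"
  assumes \<tau>: "\<tau> = (d + 2) * (5 ^ Suc d + 10)"
    and R: "\<tau> \<le> R n"
    and M: "M n \<in> sets X" "discrete_at (20 * R n) (M n)"
    and P: "P n \<in> sets X" "P n \<subseteq> thick (3 * R n) (M n)"
    and P_nested: "k < n \<Longrightarrow> thick \<tau> (P k) \<inter> thick \<tau> (P n) \<subseteq> P n"
    and P_cover: "x \<in> space X \<Longrightarrow> \<exists>n. x \<in> P n"
begin

text \<open>Consecutive radii differ by the block length plus 10, so the bands in
  \<open>border\<close> are disjoint for distinct directions; all of them stay below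
  \<open>\<tau>\<close>.\<close>

definition radius :: "nat \<Rightarrow> nat" where
  "radius i = Suc i * (5 ^ Suc d + 10)"

text \<open>The position of \<open>x\<close> relative to its marker of level \<open>n\<close>. The
  bound is the \<open>3 * R n\<close> of the region plus a margin
  \<open>\<tau> \<le> R n\<close>.\<close>

definition coord :: "nat \<Rightarrow> 'a \<Rightarrow> (nat \<Rightarrow> int) \<Rightarrow> bool" where
  "coord n x v \<longleftrightarrow> v \<in> ibox (4 * R n) \<and> act (- v) x \<in> M n"

text \<open>A block of a line in direction \<open>i\<close> is taken in entirely as soon as one of
  its points lies in the thickened \<open>P n\<close>; hence the region can end in direction
  \<open>i\<close> only at block ends.\<close>

definition region :: "nat \<Rightarrow> nat \<Rightarrow> 'a set" where
  "region i n = {x \<in> space X. \<exists>v\<in>ibox (4 * R n). act (- v) x \<in> M n \<and>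
     (\<exists>k. act (unit_vec i k) x \<in> thick (radius i) (P n) \<and>
       (slant d i v + k) div 5 ^ Suc d = slant d i v div 5 ^ Suc d)}"

text \<open>The coordinate is read off in the region of least level that contains the point.\<close>

definition phase :: "nat \<Rightarrow> 'a set" where
  "phase i = {x \<in> space X. \<exists>n. x \<in> region i n \<and> (\<forall>k. k < n \<longrightarrow> x \<notin> region i k) \<and>
     (\<exists>v\<in>ibox (4 * R n). act (- v) x \<in> M n \<and> odd (v i))}"

text \<open>The band in which the boundary of \<open>region i n\<close> can run, widened by 4 on
  either side.\<close>

definition border :: "nat \<Rightarrow> nat \<Rightarrow> 'a \<Rightarrow> bool" where
  "border i n y \<longleftrightarrow> y \<in> thick (radius i + 5 ^ Suc d + 4) (P n) \<and> y \<notin> thick (radius i - 4) (P n)"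

lemma P_space: "P n \<subseteq> space X"
  using sets.sets_into_space[OF P(1)] .

lemma radius_bound: "i < d \<Longrightarrow> radius i + 5 ^ Suc d + 4 \<le> \<tau>"
proof -
  assume "i < d"
  then have "Suc i * (5 ^ Suc d + 10) \<le> (d + 1) * (5 ^ Suc d + 10 :: nat)" by (intro mult_right_mono) auto
  moreover have "(d + 2) * (5 ^ Suc d + 10 :: nat) = (d + 1) * (5 ^ Suc d + 10) + (5 ^ Suc d + 10)"
    by (simp add: algebra_simps)
  ultimately show ?thesis unfolding radius_def \<tau> by linarith
qed

lemma radius_gap: "i < j \<Longrightarrow> radius i + 5 ^ Suc d + 10 \<le> radius j"
proof -
  assume "i < j"
  then have "Suc (Suc i) * (5 ^ Suc d + 10) \<le> Suc j * (5 ^ Suc d + 10 :: nat)" by (intro mult_right_mono) auto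
  then show ?thesis by (simp add: radius_def)
qed

lemma radius_ge: "4 \<le> radius i"
  by (simp add: radius_def)

lemma unit_vec_in_ibox: "i < d \<Longrightarrow> \<bar>k\<bar> \<le> int l \<Longrightarrow> unit_vec i k \<in> ibox l"
  by (auto simp: ibox_def unit_vec_def)

lemma act_unit_vec:
  "x \<in> space X \<Longrightarrow> act (unit_vec i k) (act (unit_vec i l) x) = act (unit_vec i (k + l)) x"
proof -
  have "unit_vec i (k + l) = unit_vec i k + unit_vec i l" by (auto simp: unit_vec_def)
  then show "x \<in> space X \<Longrightarrow> ?thesis" by (simp only: act_add)
qed

lemma coord_exists:
  assumes "x \<in> thick \<tau> (P n)" shows "\<exists>v. coord n x v"
proof -
  have "x \<in> thick \<tau> (thick (3 * R n) (M n))"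
    using assms thick_mono[OF P(2) order_refl] by blast
  then have "x \<in> thick (4 * R n) (M n)"
    by (rule thick_thick) (use R[of n] in simp)
  then obtain v where "v \<in> ibox (4 * R n)" "act v x \<in> M n"
    by (auto simp: thick_def)
  then show ?thesis unfolding coord_def by (metis minus_minus uminus_in_ibox)
qed

text \<open>Both points see the same marker, because their markers are within
  \<open>20 * R n\<close>; freeness then determines the displacement.\<close>

lemma coord_step:
  assumes x: "x \<in> space X" and v: "coord n x v" "coord n (act u x) v'" and u: "u \<in> ibox 4"
  shows "v' = u + v"
proof -
  define m where "m = act (- v) x"
  have ms: "m \<in> space X" using x by (simp add: m_def)
  have u': "u \<in> ibox (4 * R n)" 
    using R[of n] ibox_mono[OF _ u] by (auto simp: \<tau>)
  have "act (- v' + (u + v)) m = act (- v') (act u x)"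
    using x ms by (simp only: act_add act_space) (simp add: m_def x)
  then have "act (- v' + (u + v)) m \<in> M n" "m \<in> M n"
    using v by (auto simp: coord_def m_def)
  moreover have b: "- v' + (u + v) \<in> ibox (4 * R n + (4 * R n + 4 * R n))"
    using v u' by (intro add_in_ibox) (auto simp: coord_def)
  then have "near (20 * R n) m (act (- v' + (u + v)) m)"
    using near_mono[OF near_act[OF b]] by simp
  ultimately have "act (- v' + (u + v)) m = m"
    using M(2)[of n] by (metis discrete_at_def)
  then have "- v' + (u + v) = 0"
    using ibox_support[OF b] by (intro act_free[OF ms]) auto
  then show ?thesis by (metis add.inverse_inverse add.left_cancel add.left_inverse)
qed

lemma coord_unique: "x \<in> space X \<Longrightarrow> coord n x v \<Longrightarrow> coord n x v' \<Longrightarrow> v' = v"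
  using coord_step[of x n v 0 v'] act_zero by simp

lemma region_iff:
  "x \<in> region i n \<longleftrightarrow> x \<in> space X \<and> (\<exists>v. coord n x v \<and>
     (\<exists>k. act (unit_vec i k) x \<in> thick (radius i) (P n) \<and>
       (slant d i v + k) div 5 ^ Suc d = slant d i v div 5 ^ Suc d))"
  by (auto simp: region_def coord_def)

lemma region_sets [measurable]: "region i n \<in> sets X"
  unfolding region_def
  by (intro sets.sets_Collect_finite_Ex sets.sets_Collect_conj sets.sets_Collect_countable_Ex
      sets.sets_Collect_const sets_act sets_thick M P finite_ibox)

lemma phase_sets: "phase i \<in> sets X"
proof -
  have "{x \<in> space X. x \<in> region i n} \<in> sets X" for n
    using region_sets by measurable
  then show ?thesis
    unfolding phase_def
    by (intro sets.sets_Collect_finite_Ex sets.sets_Collect_conj sets.sets_Collect_countable_Ex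
        sets.sets_Collect_countable_All sets.sets_Collect_imp sets.sets_Collect_neg
        sets.sets_Collect_const sets_act M finite_ibox)
qed

lemma thick_subset_region:
  assumes "i < d" shows "thick (radius i) (P n) \<subseteq> region i n"
proof
  fix x assume x: "x \<in> thick (radius i) (P n)"
  then have "x \<in> thick \<tau> (P n)"
    using thick_mono[OF order_refl, of "radius i" \<tau> "P n"] radius_bound[OF assms] by auto
  then obtain v where "coord n x v" using coord_exists by blast
  moreover have "unit_vec i 0 = 0" by (auto simp: unit_vec_def)
  ultimately show "x \<in> region i n"
    using x thick_space act_zero unfolding region_iff
    by (intro conjI exI[of _ v] exI[of _ 0]) (auto simp: thick_iff)
qed

lemma region_subset_thick:
  assumes "i < d" shows "region i n \<subseteq> thick (radius i + 5 ^ Suc d) (P n)"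
proof
  fix x assume "x \<in> region i n"
  then obtain v k where x: "x \<in> space X" and k: "act (unit_vec i k) x \<in> thick (radius i) (P n)"
    and dv: "(slant d i v + k) div 5 ^ Suc d = slant d i v div 5 ^ Suc d"
    by (auto simp: region_iff)
  have "\<bar>k\<bar> < 5 ^ Suc d" using div_eq_imp_abs_less[OF dv] by simp
  then have "near (5 ^ Suc d) x (act (unit_vec i k) x)"
    using assms by (intro near_act unit_vec_in_ibox) auto
  then show "x \<in> thick (radius i + 5 ^ Suc d) (P n)"
    using near_thick[OF k near_sym[OF x]] by simp
qed

text \<open>Membership is constant along a block: a witness \<open>k\<close> for \<open>x\<close>
  becomes \<open>k - e\<close> for its neighbour.\<close>

lemma region_step:
  assumes i: "i < d" and e: "\<bar>e\<bar> \<le> 1" and x: "x \<in> region i n"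
    and y: "act (unit_vec i e) x \<notin> region i n" and v: "coord n x v"
  shows "(slant d i v + e) div 5 ^ Suc d \<noteq> slant d i v div 5 ^ Suc d"
proof
  assume eq: "(slant d i v + e) div 5 ^ Suc d = slant d i v div 5 ^ Suc d"
  have xs: "x \<in> space X" using x by (simp add: region_iff)
  obtain k where k: "act (unit_vec i k) x \<in> thick (radius i) (P n)"
    "(slant d i v + k) div 5 ^ Suc d = slant d i v div 5 ^ Suc d"
    using x coord_unique[OF xs v] by (auto simp: region_iff)
  have e4: "unit_vec i e \<in> ibox 4" using e i by (intro unit_vec_in_ibox) auto
  have "x \<in> thick (radius i + 5 ^ Suc d) (P n)" using region_subset_thick[OF i] x by blast
  then have "act (unit_vec i e) x \<in> thick \<tau> (P n)"
    using near_thick[OF _ near_act[OF e4]] radius_bound[OF i] by blast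
  then obtain v' where v': "coord n (act (unit_vec i e) x) v'" using coord_exists by blast
  have "v' = unit_vec i e + v" using coord_step[OF xs v v' e4] .
  then have s: "slant d i v' = slant d i v + e" by (simp add: slant_add slant_unit_vec)
  have "act (unit_vec i (k - e)) (act (unit_vec i e) x) = act (unit_vec i k) x"
    using act_unit_vec[OF xs] by simp
  then have "act (unit_vec i e) x \<in> region i n"
    using xs v' k s eq unfolding region_iff by (intro conjI exI[of _ v'] exI[of _ "k - e"]) auto
  then show False using y by simp
qed

lemma border_between:
  assumes "i < d" "x \<in> region i n" "x' \<notin> region i n" "y \<in> space X" "near 4 y x" "near 4 y x'"
  shows "border i n y"
  unfolding border_def
proof
  show "y \<in> thick (radius i + 5 ^ Suc d + 4) (P n)"
    using near_thick[OF _ near_sym[OF assms(4,5)]] region_subset_thick[OF assms(1)] assms(2) by blast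
  show "y \<notin> thick (radius i - 4) (P n)"
    using near_thick[OF _ assms(6)] radius_ge[of i] thick_subset_region[OF assms(1)] assms(3)
    by (metis le_add_diff_inverse2 order_refl subsetD)
qed

text \<open>For two levels, \<open>P_nested\<close> would put \<open>y\<close> inside the higher
  region, away from its border. For two directions on one level, the gap between the radii separates
  the bands.\<close>

lemma border_unique:
  assumes "border i n y" "border j m y" "i < d" "j < d"
  shows "i = j \<and> n = m"
proof -
  have lev: "n = m" if "border i n y" "border j m y" "n \<le> m" "i < d" "j < d" for i j n m
  proof (rule ccontr)
    assume "n \<noteq> m"
    then have "n < m" using that by simp
    moreover have "y \<in> thick \<tau> (P n)" "y \<in> thick \<tau> (P m)"
      using that radius_bound thick_mono[OF order_refl] unfolding border_def by blast+
    ultimately have "y \<in> P m" using P_nested by blast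
    then show False
      using that(2) subset_thick[OF P_space] by (auto simp: border_def)
  qed
  have dir: False if "border i n y" "border j n y" "i < j" for i j
  proof -
    have "radius i + 5 ^ Suc d + 4 \<le> radius j - 4" using radius_gap[OF that(3)] by simp
    then show False using that thick_mono[OF order_refl] unfolding border_def by blast
  qed
  have "n = m" using lev assms by (metis nat_le_linear)
  then show ?thesis using dir assms by (metis linorder_neqE_nat)
qed

lemma mem_phase_iff:
  assumes "x \<in> region i n" "\<forall>k<n. x \<notin> region i k" "coord n x v"
  shows "x \<in> phase i \<longleftrightarrow> odd (v i)"
proof
  have xs: "x \<in> space X" using assms(1) by (simp add: region_iff)
  show "odd (v i)" if "x \<in> phase i"
  proof -
    obtain n' v' where n': "x \<in> region i n'" "\<forall>k<n'. x \<notin> region i k" "coord n' x v'" "odd (v' i)"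
      using \<open>x \<in> phase i\<close> by (auto simp: phase_def coord_def)
    then have "n' = n" using assms by (metis linorder_neqE_nat)
    then show ?thesis using coord_unique[OF xs assms(3)] n' by blast
  qed
  show "x \<in> phase i" if "odd (v i)"
    using that assms xs by (auto simp: phase_def coord_def)
qed

text \<open>Without a region boundary in between, both points use the same first region, and their
  coordinates there differ by \<open>u\<close>.\<close>

lemma phase_step:
  assumes i: "i < d" and x: "x \<in> space X" and u: "u \<in> ibox 1"
    and same: "\<And>n. x \<in> region i n \<longleftrightarrow> act u x \<in> region i n"
  shows "act u x \<in> phase i \<longleftrightarrow> (x \<in> phase i) \<noteq> odd (u i)"
proof -
  have "\<exists>n. x \<in> region i n"
    using P_cover[OF x] subset_thick[OF P_space] thick_subset_region[OF i] by blast
  then obtain n where n: "x \<in> region i n" "\<forall>k<n. x \<notin> region i k"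
    using exists_least_iff[of "\<lambda>n. x \<in> region i n"] by blast
  then have n': "act u x \<in> region i n" "\<forall>k<n. act u x \<notin> region i k" using same by auto
  obtain v v' where v: "coord n x v" "coord n (act u x) v'"
    using n n' by (auto simp: region_iff)
  have "v' = u + v" using coord_step[OF x v] ibox_mono[OF _ u, of 4] by simp
  then show ?thesis
    using mem_phase_iff[OF n v(1)] mem_phase_iff[OF n' v(2)] by auto
qed

text \<open>By \<open>border_unique\<close>, at most one direction has a border at \<open>y\<close>;
  in all others \<open>phase_step\<close> applies.\<close>

lemma phase_regular:
  assumes "y \<in> space X"
  shows "\<exists>i. \<forall>j<d. j \<noteq> i \<longrightarrow> (\<forall>w\<in>ibox 1. act w y \<in> phase j \<longleftrightarrow> (y \<in> phase j) \<noteq> odd (w j))"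
proof -
  have *: "act w y \<in> phase j \<longleftrightarrow> (y \<in> phase j) \<noteq> odd (w j)"
    if "j < d" "\<And>n. \<not> border j n y" "w \<in> ibox 1" for j w
  proof (rule phase_step[OF that(1) assms that(3)])
    fix n
    have "near 4 y (act w y)" "near 4 y y"
      using near_mono[OF near_act[OF that(3)]] assms by auto
    then show "y \<in> region j n \<longleftrightarrow> act w y \<in> region j n"
      using border_between[OF that(1) _ _ assms] that(2) by blast
  qed
  show ?thesis
  proof (cases "\<exists>i<d. \<exists>n. border i n y")
    case True
    then obtain i n where "i < d" "border i n y" by blast
    then show ?thesis using * border_unique by blast
  qed (use * in blast)
qed

section \<open>Isolation of walls\<close>

definition wall :: "nat \<Rightarrow> 'a \<Rightarrow> bool" where
  "wall i x \<longleftrightarrow> (act (unit_vec i 1) x \<in> phase i \<longleftrightarrow> x \<in> phase i)"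

text \<open>Parity fails to alternate only where a region boundary is crossed, which in direction
  \<open>i\<close> happens at block ends.\<close>

lemma wall_residue:
  assumes i: "i < d" and x: "x \<in> space X" and w: "wall i x"
  obtains n v where "x \<in> region i n \<longleftrightarrow> act (unit_vec i 1) x \<notin> region i n" "coord n x v"
    "5 ^ Suc d dvd slant d i v + 1"
proof -
  define y where "y = act (unit_vec i 1) x"
  have u: "unit_vec i 1 \<in> ibox 1" using i by (intro unit_vec_in_ibox) auto
  have u4: "unit_vec i 1 \<in> ibox 4" using ibox_mono[OF _ u] by simp
  have "odd (unit_vec i 1 i)" by (simp add: unit_vec_def)
  then obtain n where n: "x \<in> region i n \<longleftrightarrow> y \<notin> region i n"
    using phase_step[OF i x u] w unfolding wall_def y_def by blast
  have ys: "y \<in> space X" using x by (simp add: y_def)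
  have xy: "act (unit_vec i (-1)) y = x"
    using act_unit_vec[OF x, of i "-1" 1] act_zero[OF x] unfolding y_def
    by (simp add: unit_vec_def zero_fun_def)
  have "near 1 x y" using near_act[OF u] by (simp add: y_def)
  have "x \<in> thick (radius i + 5 ^ Suc d + 4) (P n)"
    using n near_thick[OF _ near_sym[OF x \<open>near 1 x y\<close>]] near_thick[OF _ near_refl[OF x, of 0]]
      region_subset_thick[OF i] by (metis add_le_cancel_left one_le_numeral subsetD zero_le)
  then have "x \<in> thick \<tau> (P n)"
    using thick_mono[OF order_refl radius_bound[OF i]] by blast
  then obtain v where v: "coord n x v" using coord_exists by blast
  have "(slant d i v + 1) div 5 ^ Suc d \<noteq> slant d i v div 5 ^ Suc d"
  \<comment> \<open>The step is taken from whichever endpoint lies inside the region: forwards from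
    \<open>x\<close> or backwards from \<open>y\<close>.\<close>
  proof (cases "x \<in> region i n")
    case True
    then show ?thesis using region_step[OF i _ True _ v, of 1] n by (simp add: y_def)
  next
    case False
    then have yr: "y \<in> region i n" using n by simp
    then obtain v' where v': "coord n y v'" by (auto simp: region_iff)
    have "v' = unit_vec i 1 + v" using coord_step[OF x v _ u4] v' by (simp add: y_def)
    then have "slant d i v' = slant d i v + 1" by (simp add: slant_add slant_unit_vec)
    then show ?thesis using region_step[OF i _ yr _ v', of "-1"] False xy by simp
  qed
  then have "5 ^ Suc d dvd slant d i v + 1" by (rule div_succ_neq_imp_dvd) simp
  then show ?thesis using that n v unfolding y_def by blast
qed

text \<open>Both walls produce a border at \<open>x\<close>, so they share direction, level and
  marker. Their displacement then has entries of absolute value at most 2 and slant divisible by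
  \<open>5 ^ Suc d\<close>, hence is zero.\<close>

lemma wall_isolated:
  assumes i: "i < d" and j: "j < d" and x: "x \<in> space X" and "wall i x" "wall j x'" "near 2 x x'"
  shows "i = j \<and> x = x'"
proof -
  have x': "x' \<in> space X" using near_space assms by blast
  obtain n v where n: "x \<in> region i n \<longleftrightarrow> act (unit_vec i 1) x \<notin> region i n" "coord n x v"
    "5 ^ Suc d dvd slant d i v + 1"
    using wall_residue[OF i x] assms(4) .
  obtain m v' where m: "x' \<in> region j m \<longleftrightarrow> act (unit_vec j 1) x' \<notin> region j m" "coord m x' v'"
    "5 ^ Suc d dvd slant d j v' + 1"
    using wall_residue[OF j x'] assms(5) .
  have "near 1 x (act (unit_vec i 1) x)" "near 1 x' (act (unit_vec j 1) x')"
    using i j by (auto intro!: near_act unit_vec_in_ibox)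
  \<comment> \<open>The far end of the second wall is at distance at most 3, within the margin 4 of
    \<open>border\<close>.\<close>
  then have nr: "near 4 x (act (unit_vec i 1) x)" "near 4 x (act (unit_vec j 1) x')" "near 4 x x'" "near 4 x x"
    using near_mono near_trans[OF x assms(6)] assms(6) x by (auto intro: near_mono)
  have "border i n x" "border j m x"
    using border_between[OF i _ _ x] border_between[OF j _ _ x] nr n(1) m(1) by blast+
  then have eq: "i = j" "n = m" using border_unique i j by blast+
  obtain u where u: "u \<in> ibox 2" "x' = act u x" using assms(6) by (auto simp: near_def)
  have "v' = u + v"
    using coord_step[OF x n(2), of u v'] m(2) eq u ibox_mono[OF _ u(1), of 4] by simp
  then have "slant d i v' = slant d i u + slant d i v" by (simp add: slant_add)
  then have "5 ^ Suc d dvd slant d i u"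
    using n(3) m(3) eq by (metis add.assoc dvd_add_left_iff)
  then have "u l = 0" if "l < d" for l
    using slant_dvd_imp_zero[of u i d l] u(1) i that by (auto simp: ibox_def)
  then have "u = 0" using u(1) by (auto simp: ibox_def fun_eq_iff) (metis not_less)
  then show ?thesis using eq u act_zero[OF x] by simp
qed

subsection \<open>The colouring\<close>

definition parity_class :: "'a \<Rightarrow> nat set" where
  "parity_class x = {i. i < d \<and> x \<in> phase i}"

definition flip :: "nat \<Rightarrow> nat set \<Rightarrow> nat set" where
  "flip i A = (if i \<in> A then A - {i} else insert i A)"

definition cube :: "(nat \<Rightarrow> int) set" where
  "cube = {w. (\<forall>i<d. w i \<in> {0, 1}) \<and> (\<forall>i\<ge>d. w i = 0)}"

lemma cube_subset_ibox:
  assumes "w \<in> cube" shows "w \<in> ibox 1"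
proof -
  have "\<bar>w i\<bar> \<le> 1" for i
    using assms by (cases "i < d") (fastforce simp: cube_def)+
  then show ?thesis using assms by (simp add: ibox_def cube_def)
qed

lemma near_cube:
  assumes "y \<in> space X" "w \<in> cube" "w' \<in> cube" shows "near 1 (act w y) (act w' y)"
proof -
  have "\<bar>w' i - w i\<bar> \<le> 1" for i
  proof (cases "i < d")
    case True
    then have "w i \<in> {0, 1}" "w' i \<in> {0, 1}" using assms by (auto simp: cube_def)
    then show ?thesis by auto
  qed (use assms in \<open>auto simp: cube_def\<close>)
  then have "w' - w \<in> ibox 1" using assms by (auto simp: ibox_def cube_def)
  moreover have "act (w' - w) (act w y) = act w' y"
  proof -
    have "act (w' - w) (act w y) = act ((w' - w) + w) y" using assms(1) by (simp only: act_add)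
    then show ?thesis by simp
  qed
  ultimately show ?thesis by (auto simp: near_def)
qed

lemma parity_class_eqI:
  "A \<subseteq> {..<d} \<Longrightarrow> (\<And>j. j < d \<Longrightarrow> x \<in> phase j \<longleftrightarrow> j \<in> A) \<Longrightarrow> parity_class x = A"
  by (auto simp: parity_class_def)

lemma flip_flip: "flip i (flip i A) = A"
  by (auto simp: flip_def)

text \<open>All directions but one are regular and can be solved independently. The remaining one
  leaves an edge: either one of its ends has class \<open>A\<close>, or it is a wall whose base has
  class \<open>flip i A\<close>.\<close>

lemma cube_hits_class:
  assumes y: "y \<in> space X" and A: "A \<subseteq> {..<d}"
  shows "(\<exists>w\<in>cube. parity_class (act w y) = A) \<or>
    (\<exists>w\<in>cube. \<exists>i<d. wall i (act w y) \<and> flip i (parity_class (act w y)) = A)"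
proof -
  obtain i where reg: "\<And>j w. j < d \<Longrightarrow> j \<noteq> i \<Longrightarrow> w \<in> ibox 1 \<Longrightarrow>
      act w y \<in> phase j \<longleftrightarrow> (y \<in> phase j) \<noteq> odd (w j)"
    using phase_regular[OF y] by blast
  define w :: "nat \<Rightarrow> int"
    \<comment> \<open>Corrects every wrong parity outside direction \<open>i\<close>, where the
      entry stays 0; \<open>w'\<close> is the other end of the edge.\<close>
    where "w = (\<lambda>l. if l < d \<and> l \<noteq> i \<and> (l \<in> A) \<noteq> (y \<in> phase l) then 1 else 0)"
  define w' where "w' = unit_vec i 1 + w"
  have w: "w \<in> cube" by (auto simp: cube_def w_def)
  have x: "act w y \<in> phase j \<longleftrightarrow> j \<in> A" if "j < d" "j \<noteq> i" for j
    using reg[OF that cube_subset_ibox[OF w]] that by (auto simp: w_def)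
  show ?thesis
  proof (cases "i < d \<and> \<not> (act w y \<in> phase i \<longleftrightarrow> i \<in> A)")
    case False
    then have "parity_class (act w y) = A"
      using x by (intro parity_class_eqI[OF A]) metis
    then show ?thesis using w by blast
  next
    case i: True
    have w': "w' \<in> cube"
      using i by (auto simp: cube_def w'_def w_def unit_vec_def)
    have x': "act w' y \<in> phase j \<longleftrightarrow> j \<in> A" if "j < d" "j \<noteq> i" for j
      using reg[OF that cube_subset_ibox[OF w']] that by (auto simp: w_def w'_def unit_vec_def)
    show ?thesis
    proof (cases "act w' y \<in> phase i \<longleftrightarrow> i \<in> A")
      case True
      then have "parity_class (act w' y) = A"
        using x' by (intro parity_class_eqI[OF A]) metis
      then show ?thesis using w' by blast
    next
      case False
      have "act w' y = act (unit_vec i 1) (act w y)"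
        unfolding w'_def using y by (rule act_add)
      then have "wall i (act w y)" using False i by (auto simp: wall_def)
      moreover have "parity_class (act w y) = flip i A"
      proof (rule parity_class_eqI)
        show "act w y \<in> phase j \<longleftrightarrow> j \<in> flip i A" if "j < d" for j
          using x[OF that] i by (cases "j = i") (auto simp: flip_def)
      qed (use A i in \<open>auto simp: flip_def\<close>)
      then have "flip i (parity_class (act w y)) = A" by (simp add: flip_flip)
      ultimately show ?thesis using w i by blast
    qed
  qed
qed

text \<open>\<open>A\<close> is the class missed at a wall within distance 1. The class
  \<open>{}\<close> is excluded as it is no colour, \<open>{..<d}\<close> because it is the default
  colour of \<open>{}\<close> anyway.\<close>

definition recoloured :: "'a \<Rightarrow> nat set \<Rightarrow> bool" where
  "recoloured x A \<longleftrightarrow> parity_class x = {} \<and> A \<noteq> {} \<and> A \<noteq> {..<d} \<and>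
     (\<exists>v\<in>ibox 1. \<exists>i\<in>{..<d}. wall i (act v x) \<and> flip i (parity_class (act v x)) = A)"

text \<open>The classes \<open>{}\<close> and \<open>{..<d}\<close> share a colour. A unit cube containing a wall misses one class,
  whose colour is supplied by the points of the redundant class \<open>{}\<close> next to that wall.\<close>

definition colour :: "'a \<Rightarrow> nat set" where
  "colour x = (if parity_class x \<noteq> {} then parity_class x
     else if \<exists>A. recoloured x A then (THE A. recoloured x A) else {..<d})"

text \<open>Two walls within distance 1 of \<open>x\<close> are within 2 of each other, hence equal.
  This justifies the definite description in \<open>colour\<close>.\<close>

lemma recoloured_unique:
  assumes x: "x \<in> space X" and "recoloured x A" "recoloured x B" shows "A = B"
proof -
  obtain v i where v: "v \<in> ibox 1" "i < d" "wall i (act v x)" "flip i (parity_class (act v x)) = A"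
    using assms(2) by (auto simp: recoloured_def)
  obtain v' j where v': "v' \<in> ibox 1" "j < d" "wall j (act v' x)" "flip j (parity_class (act v' x)) = B"
    using assms(3) by (auto simp: recoloured_def)
  have "near 2 (act v x) (act v' x)"
    using near_trans[OF act_space[OF x] near_sym[OF x near_act[OF v(1)]] near_act[OF v'(1)], of 2]
    by simp
  then have "i = j \<and> act v x = act v' x"
    using wall_isolated[OF v(2) v'(2) act_space[OF x] v(3) v'(3)] by blast
  then show ?thesis using v(4) v'(4) by simp
qed

lemma recoloured_subset: "recoloured x A \<Longrightarrow> A \<subseteq> {..<d}"
  by (auto simp: recoloured_def flip_def parity_class_def split: if_splits)

lemma colour_recoloured:
  assumes "x \<in> space X" "recoloured x A" shows "colour x = A"
proof -
  have "(THE A. recoloured x A) = A"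
    using assms recoloured_unique by (intro the_equality) auto
  moreover have "parity_class x = {}"
    using assms(2) by (simp add: recoloured_def)
  ultimately show ?thesis
    using assms(2) by (auto simp: colour_def)
qed

lemma colour_range:
  assumes "d \<ge> 1" "x \<in> space X" shows "colour x \<in> Pow {..<d} - {{}}"
proof (cases "\<exists>A. recoloured x A")
  case True
  then obtain A where A: "recoloured x A" by blast
  then show ?thesis
    using colour_recoloured[OF assms(2) A] recoloured_subset[OF A] by (auto simp: recoloured_def)
next
  case False
  moreover have "0 \<in> {..<d}" using assms(1) by simp
  ultimately show ?thesis by (auto simp: colour_def parity_class_def)
qed

lemma parity_class_sets: "{x \<in> space X. parity_class x = A} \<in> sets X"
proof -
  have "{x \<in> space X. x \<in> phase i} \<in> sets X" for i
    using phase_sets by measurable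
  moreover have "parity_class x = A \<longleftrightarrow>
      (\<forall>i. (i < d \<and> x \<in> phase i \<longrightarrow> i \<in> A) \<and> (i \<in> A \<longrightarrow> i < d \<and> x \<in> phase i))" for x
    by (auto simp: parity_class_def)
  ultimately show ?thesis
    by (simp only:) (intro sets.sets_Collect_countable_All sets.sets_Collect_conj sets.sets_Collect_imp
        sets.sets_Collect_const)
qed

lemma wall_sets: "{x \<in> space X. wall i x} \<in> sets X"
proof -
  have "{x \<in> space X. x \<in> phase i} \<in> sets X"
    using phase_sets by measurable
  then show ?thesis
    unfolding wall_def iff_conv_conj_imp
    by (intro sets.sets_Collect_conj sets.sets_Collect_imp sets_act phase_sets)
qed

lemma recoloured_sets: "{x \<in> space X. recoloured x A} \<in> sets X"
proof -
  \<comment> \<open>Solving for the class turns the condition into membership in a single parity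
    class.\<close>
  have flip: "flip i B = A \<longleftrightarrow> B = flip i A" for i B
    using flip_flip by metis
  have "{x \<in> space X. wall i (act v x)} \<in> sets X" "{x \<in> space X. parity_class (act v x) = B} \<in> sets X"
    for i v B
    using sets_act[OF wall_sets, of v i] sets_act[OF parity_class_sets, of v B]
    by (simp_all cong: conj_cong)
  then show ?thesis
    unfolding recoloured_def flip
    by (intro sets.sets_Collect_conj sets.sets_Collect_const sets.sets_Collect_finite_Ex
        parity_class_sets finite_ibox finite_lessThan)
qed

lemma colour_sets:
  assumes "d \<ge> 1" shows "{x \<in> space X. colour x = A} \<in> sets X"
proof -
  \<comment> \<open>Trades the definite description for a finite Boolean combination of Borel
    conditions.\<close>
  have "colour x = A \<longleftrightarrow> parity_class x = A \<and> A \<noteq> {} \<or> recoloured x A \<or>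
      parity_class x = {} \<and> A = {..<d} \<and> (\<forall>B\<in>Pow {..<d}. \<not> recoloured x B)" if x: "x \<in> space X" for x
  proof (cases "\<exists>B. recoloured x B")
    case True
    then obtain B where B: "recoloured x B" by blast
    have "recoloured x A \<longleftrightarrow> A = B" using B recoloured_unique[OF x B] by blast
    moreover have "parity_class x = {}" using B by (simp add: recoloured_def)
    ultimately show ?thesis
      using colour_recoloured[OF x B] recoloured_subset[OF B] B by blast
  next
    case False
    then show ?thesis by (auto simp: colour_def)
  qed
  then have "{x \<in> space X. colour x = A} = {x \<in> space X. parity_class x = A \<and> A \<noteq> {} \<or> recoloured x A \<or>
      parity_class x = {} \<and> A = {..<d} \<and> (\<forall>B\<in>Pow {..<d}. \<not> recoloured x B)}"
    by blast
  also have "\<dots> \<in> sets X"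
    by (intro sets.sets_Collect_disj sets.sets_Collect_conj sets.sets_Collect_const parity_class_sets
        recoloured_sets sets.sets_Collect_finite_All sets.sets_Collect_neg) auto
  finally show ?thesis .
qed

text \<open>If the class \<open>A\<close> is missing, the cube contains a wall. It cannot miss
  \<open>{}\<close> as well, since by isolation the same wall would give \<open>A = {}\<close>. A
  point of class \<open>{}\<close> in the cube then supplies the colour \<open>A\<close>.\<close>

lemma cube_hits_colour:
  assumes d: "d \<ge> 1" and y: "y \<in> space X" and A: "A \<in> Pow {..<d} - {{}}"
  shows "\<exists>w\<in>cube. colour (act w y) = A"
proof (cases "\<exists>w\<in>cube. parity_class (act w y) = A")
  case True
  then show ?thesis using A by (auto simp: colour_def)
next
  case False
  then obtain w i where w: "w \<in> cube" "i < d" "wall i (act w y)" "flip i (parity_class (act w y)) = A"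
    using cube_hits_class[OF y] A by blast
  have unique: "B = A" if "j < d" "wall j x" "flip j (parity_class x) = B" "near 2 (act w y) x" for j x B
    using wall_isolated[OF w(2) that(1) act_space[OF y] w(3) that(2,4)] w(4) that(3) by auto
  obtain w' where w': "w' \<in> cube" "parity_class (act w' y) = {}"
  proof (cases "\<exists>w'\<in>cube. parity_class (act w' y) = {}")
    case False
    then obtain w' j where "w' \<in> cube" "j < d" "wall j (act w' y)" "flip j (parity_class (act w' y)) = {}"
      using cube_hits_class[OF y, of "{}"] by blast
    then have "{} = A"
      using unique near_mono[OF near_cube[OF y w(1)]] by (metis one_le_numeral)
    then show ?thesis using A by blast
  qed (use that in blast)
  define z where "z = act w' y"
  have z: "z \<in> space X" "parity_class z = {}" using y w' by (auto simp: z_def)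
  have zx: "near 1 z (act w y)" "near 1 (act w y) z"
    using near_cube[OF y] w w' by (auto simp: z_def)
  have "colour z = A"
  proof (cases "A = {..<d}")
    case False
    obtain v where "v \<in> ibox 1" "act v z = act w y" using zx by (auto simp: near_def)
    then have "recoloured z A"
      using False A z w unfolding recoloured_def by (metis DiffD2 insertCI lessThan_iff)
    then show ?thesis using colour_recoloured z by blast
  next
    case True
    \<comment> \<open>The default colour must survive: the only wall near \<open>z\<close> is the
      present one, and its missed class \<open>{..<d}\<close> is excluded from recolouring.\<close>
    have "\<not> recoloured z B" for B
    proof
      assume "recoloured z B"
      then obtain v j where v: "v \<in> ibox 1" "j < d" "wall j (act v z)" "flip j (parity_class (act v z)) = B"
        and B: "B \<noteq> {..<d}" by (auto simp: recoloured_def)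
      have "near 2 (act w y) (act v z)"
        using near_trans[OF act_space[OF y] zx(2) near_act[OF v(1)]] by simp
      then show False using unique[OF v(2-4)] B True by simp
    qed
    then show ?thesis using z True by (auto simp: colour_def)
  qed
  then show ?thesis using w' by (auto simp: z_def)
qed

end

lemma (in free_Zd_action) polychromatic_classes:
  assumes "d \<ge> 1"
  shows "\<exists>c :: 'a \<Rightarrow> nat set. (\<forall>A. {x \<in> space X. c x = A} \<in> sets X) \<and>
    (\<forall>x\<in>space X. c x \<in> Pow {..<d} - {{}}) \<and>
    (\<forall>y\<in>space X. \<forall>A\<in>Pow {..<d} - {{}}.
      \<exists>w. (\<forall>i<d. w i \<in> {0, 1}) \<and> (\<forall>i\<ge>d. w i = 0) \<and> c (act w y) = A)"
proof -
  define \<tau> :: nat where "\<tau> = (d + 2) * (5 ^ Suc d + 10)"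
  have "\<tau> > 0" by (simp add: \<tau>_def)
  from nested_regions_exist[OF this] obtain R :: "nat \<Rightarrow> nat" and M P :: "nat \<Rightarrow> 'a set" where
    regions: "(\<forall>n. \<tau> \<le> R n \<and> M n \<in> sets X \<and> P n \<in> sets X \<and> discrete_at (20 * R n) (M n) \<and>
      P n \<subseteq> thick (3 * R n) (M n)) \<and>
    (\<forall>k n. k < n \<longrightarrow> thick \<tau> (P k) \<inter> thick \<tau> (P n) \<subseteq> P n) \<and> (\<forall>x\<in>space X. \<exists>n. x \<in> P n)"
    by (elim exE)
  interpret nested_regions d X act \<tau> R M P
    by unfold_locales (rule \<tau>_def, (simp only: regions)+)
  show ?thesis
    using colour_sets[OF assms] colour_range[OF assms] cube_hits_colour[OF assms]
    by (intro exI[of _ colour]) (auto simp: cube_def)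
qed

section \<open>Transfer to free Borel actions on standard Borel spaces\<close>

lemma separating_open_sequence:
  assumes "separable_space T" "metrizable_space T"
  shows "\<exists>U :: nat \<Rightarrow> 'a set. (\<forall>n. openin T (U n)) \<and>
    (\<forall>x\<in>topspace T. \<forall>F. finite F \<longrightarrow> F \<subseteq> topspace T - {x} \<longrightarrow> (\<exists>n. x \<in> U n \<and> U n \<inter> F = {}))"
proof -
  obtain S m where "Metric_space S m" and T: "T = Metric_space.mtopology S m"
    using assms(2) by (auto simp: metrizable_space_def)
  interpret Metric_space S m by fact
  obtain C where C: "countable C" "C \<subseteq> S" "T closure_of C = S"
    using assms(1) by (auto simp: separable_space_def T)
  \<comment> \<open>Balls of radius \<open>1 / (n + 1)\<close> around a countable dense set;
    \<open>{}\<close> makes the family nonempty even over an empty space.\<close>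
  define B where "B = insert {} ((\<lambda>(c, n). mball c (inverse (real (Suc n)))) ` (C \<times> (UNIV :: nat set)))"
  have B: "countable B" "B \<noteq> {}" using C(1) by (auto simp: B_def)
  have "openin T U" if "U \<in> B" for U
    using that by (auto simp: B_def T)
  then have "openin T (from_nat_into B n)" for n
    using from_nat_into[OF B(2)] by blast
  moreover have "\<exists>n. x \<in> from_nat_into B n \<and> from_nat_into B n \<inter> F = {}"
    if x: "x \<in> S" and F: "finite F" "F \<subseteq> S - {x}" for x F
  proof -
    have pos: "\<exists>e>0. \<forall>y\<in>F. e \<le> m x y"
    proof (cases "F = {}")
      case False
      then have "0 < Min (m x ` F)" using F x by (subst Min_gr_iff) (auto simp: subset_iff)
      then show ?thesis using F(1) by (intro exI[of _ "Min (m x ` F)"]) auto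
    qed (auto intro: zero_less_one)
    then obtain e where e: "e > 0" "\<And>y. y \<in> F \<Longrightarrow> e \<le> m x y" by blast
    \<comment> \<open>Half of the least distance, since the path from \<open>x\<close> to a point of
      \<open>F\<close> through the centre uses the radius twice.\<close>
    obtain n where n: "inverse (real (Suc n)) < e / 2"
      using reals_Archimedean[of "e / 2"] e(1) by auto
    define r where "r = inverse (real (Suc n))"
    have r: "r > 0" by (simp add: r_def)
    have "x \<in> T closure_of C" using C x by simp
    then obtain c where c: "c \<in> C" "c \<in> mball x r"
      using r by (auto simp: T metric_closure_of)
    have "x \<in> mball c r" using c(2) by (auto simp: commute)
    moreover have "mball c r \<inter> F = {}"
    proof (rule ccontr)
      assume "mball c r \<inter> F \<noteq> {}"
      then obtain y where y: "y \<in> F" "y \<in> S" "c \<in> S" "m c y < r" by auto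
      have "m x y \<le> m x c + m c y" using triangle x y by simp
      also have "\<dots> < e" using c(2) y(4) n by (simp add: r_def)
      finally show False using e(2)[OF y(1)] by simp
    qed
    moreover have "mball c r \<in> B" using c(1) by (auto simp: B_def r_def)
    ultimately show ?thesis using from_nat_into_surj[OF B(1)] by metis
  qed
  ultimately show ?thesis by (intro exI[of _ "from_nat_into B"]) (simp add: T)
qed

theorem theorem1p1:
  fixes d :: nat and X :: "'a measure" and \<phi> :: "(nat \<Rightarrow> int) \<Rightarrow> 'a \<Rightarrow> 'a"
  assumes "d \<ge> 1"
    and "standard_borel_space X"
    and "borel_action (Zd_group d) X \<phi>"
    and "free_action (Zd_group d) (space X) \<phi>"
  shows "\<exists>c. borel_polychromatic d X \<phi> (2 ^ d - 1) c"
proof -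
  \<comment> \<open>Group elements are \<open>undefined\<close> outside \<open>{..<d}\<close>, which
    pointwise addition does not respect; restricting first lets all total functions act.\<close>
  define act where "act v = \<phi> (restrict v {..<d})" for v :: "nat \<Rightarrow> int"
  interpret group_action "Zd_group d" "space X" \<phi>
    using assms(3) by (simp add: borel_action_def)
  have car: "restrict v {..<d} \<in> carrier (Zd_group d)" for v
    by (simp add: Zd_group_def)
  interpret free_Zd_action d X act
  proof
    fix v
    have "(\<lambda>x. (restrict v {..<d}, x)) \<in> X \<rightarrow>\<^sub>M count_space (carrier (Zd_group d)) \<Otimes>\<^sub>M X"
      using car by (intro measurable_Pair measurable_const measurable_ident_sets) auto
    moreover have "(\<lambda>(g, x). \<phi> g x) \<in> count_space (carrier (Zd_group d)) \<Otimes>\<^sub>M X \<rightarrow>\<^sub>M X"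
      using assms(3) by (simp add: borel_action_def)
    ultimately have "(\<lambda>x. (\<lambda>(g, x). \<phi> g x) (restrict v {..<d}, x)) \<in> X \<rightarrow>\<^sub>M X"
      by (rule measurable_compose)
    then show "act v \<in> X \<rightarrow>\<^sub>M X" by (simp add: act_def)
  next
    fix x assume x: "x \<in> space X"
    have "restrict 0 {..<d} = \<one>\<^bsub>Zd_group d\<^esub>"
      by (auto simp: Zd_group_def)
    then show "act 0 x = x" using id_eq_one x by (metis act_def restrict_apply')
  next
    fix x u v assume x: "x \<in> space X"
    have "restrict (u + v) {..<d} = restrict u {..<d} \<otimes>\<^bsub>Zd_group d\<^esub> restrict v {..<d}"
      by (auto simp: Zd_group_def)
    then show "act (u + v) x = act u (act v x)"
      using composition_rule[OF x car car] by (simp add: act_def)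
  next
    fix x v assume x: "x \<in> space X" and v: "\<And>i. i \<ge> d \<Longrightarrow> v i = 0" and eq: "act v x = x"
    have "restrict v {..<d} \<in> stabilizer (Zd_group d) \<phi> x"
      using eq car by (simp add: stabilizer_def act_def)
    then have "restrict v {..<d} = (\<lambda>i\<in>{..<d}. 0)"
      using assms(4) x by (auto simp: free_action_def Zd_group_def)
    then have "v i = 0" if "i < d" for i
      using that by (metis lessThan_iff restrict_apply')
    then show "v = 0" using v by (auto simp: fun_eq_iff) (metis not_less)
  next
    obtain T where T: "polish_space T" "topspace T = space X"
      "sets X = sigma_sets (space X) {U. openin T U}"
      using assms(2) by (auto simp: standard_borel_space_def)
    have "separable_space T" "metrizable_space T"
      using T(1) completely_metrizable_imp_metrizable_space by (auto simp: polish_space_def)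
    from separating_open_sequence[OF this] obtain U :: "nat \<Rightarrow> 'a set"
      where U: "(\<forall>n. openin T (U n)) \<and>
        (\<forall>x\<in>space X. \<forall>F. finite F \<longrightarrow> F \<subseteq> space X - {x} \<longrightarrow> (\<exists>n. x \<in> U n \<and> U n \<inter> F = {}))"
      unfolding T(2) by (rule exE)
    then have "range U \<subseteq> sets X" using T(3) by auto
    then show "\<exists>U :: nat \<Rightarrow> 'a set. range U \<subseteq> sets X \<and>
      (\<forall>x\<in>space X. \<forall>F. finite F \<longrightarrow> F \<subseteq> space X - {x} \<longrightarrow> (\<exists>n. x \<in> U n \<and> U n \<inter> F = {}))"
      using U by (intro exI[of _ U] conjI) simp_all
  qed
  from polychromatic_classes[OF assms(1)] obtain c :: "'a \<Rightarrow> nat set" where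
    c': "(\<forall>A. {x \<in> space X. c x = A} \<in> sets X) \<and> (\<forall>x\<in>space X. c x \<in> Pow {..<d} - {{}}) \<and>
      (\<forall>y\<in>space X. \<forall>A\<in>Pow {..<d} - {{}}.
        \<exists>w. (\<forall>i<d. w i \<in> {0, 1}) \<and> (\<forall>i\<ge>d. w i = 0) \<and> c (act w y) = A)"
    by (rule exE)
  note c = c'[THEN conjunct1, rule_format] c'[THEN conjunct2, THEN conjunct1, rule_format]
    and hit = c'[THEN conjunct2, THEN conjunct2, rule_format]
  have "card (Pow {..<d} - {{}}) = 2 ^ d - 1"
    by (simp add: card_Pow)
  \<comment> \<open>Numbers the nonempty subsets of \<open>{..<d}\<close>, which serve as
    colours.\<close>
  then obtain f where f: "bij_betw f (Pow {..<d} - {{}}) {..<2 ^ d - 1 :: nat}"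
    using finite_same_card_bij[of "Pow {..<d} - {{}}" "{..<2 ^ d - 1 :: nat}"] by auto
  have "borel_polychromatic d X \<phi> (2 ^ d - 1) (\<lambda>x. f (c x))"
    unfolding borel_polychromatic_def
  proof (intro conjI ballI)
    have range: "f (c x) \<in> {..<2 ^ d - 1}" if "x \<in> space X" for x
      using bij_betwE[OF f] c(2)[OF that] by blast
    have "(\<lambda>x. f (c x)) -` {k} \<inter> space X \<in> sets X" if k: "k \<in> {..<2 ^ d - 1}" for k
    proof -
      obtain A where A: "A \<in> Pow {..<d} - {{}}" "k = f A"
        using k unfolding bij_betw_imp_surj_on[OF f, symmetric] by blast
      have "f (c x) = k \<longleftrightarrow> c x = A" if "x \<in> space X" for x
        unfolding A(2) by (rule inj_on_eq_iff[OF bij_betw_imp_inj_on[OF f] c(2)[OF that] A(1)])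
      then have "(\<lambda>x. f (c x)) -` {k} \<inter> space X = {x \<in> space X. c x = A}"
        by blast
      then show ?thesis using c(1) by simp
    qed
    then show "(\<lambda>x. f (c x)) \<in> X \<rightarrow>\<^sub>M count_space {..<2 ^ d - 1}"
      using range by (subst measurable_count_space_eq2) auto
    fix y assume y: "y \<in> space X"
    show "(\<lambda>x. f (c x)) ` unit_cube d \<phi> y = {..<2 ^ d - 1}"
    proof (intro equalityI subsetI)
      fix k assume "k \<in> (\<lambda>x. f (c x)) ` unit_cube d \<phi> y"
      then obtain g where g: "g \<in> {..<d} \<rightarrow>\<^sub>E {0, 1}" "k = f (c (\<phi> g y))"
        by (auto simp: unit_cube_def)
      then have "g = restrict g {..<d}" by (auto simp: PiE_def extensional_restrict)
      then have "\<phi> g y = act g y" by (metis act_def)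
      then show "k \<in> {..<2 ^ d - 1}" using g range y by simp
    next
      fix k :: nat assume "k \<in> {..<2 ^ d - 1}"
      then obtain A where A: "A \<in> Pow {..<d} - {{}}" "k = f A"
        unfolding bij_betw_imp_surj_on[OF f, symmetric] by blast
      obtain w where w: "\<forall>i<d. w i \<in> {0, 1}" "c (act w y) = A" using hit[OF y A(1)] by blast
      have "act w y \<in> unit_cube d \<phi> y"
        using w(1) unfolding unit_cube_def act_def
        by (intro CollectI exI[of _ "restrict w {..<d}"]) auto
      then show "k \<in> (\<lambda>x. f (c x)) ` unit_cube d \<phi> y" using w(2) A(2) by blast
    qed
  qed
  then show ?thesis by blast
qed

end
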